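(* Let $m\ge1$, $1\le q<\infty$ and $0<p<\infty$. Let $Y$ be an $\mathcal L_2^g$-space and $X$ an $\mathcal L_q^g$-space (Banach spaces over $\mathbb K$). If $p\ge q$, then $\Pi_p(^mY;X)=\Pi_q(^mY;X)$. If $p\le q$, then $\Pi_p(^mY;X)\subset\Pi_q(^mY;X)$.
   Context: $\mathbb K=\mathbb R$ or $\mathbb C$. Multiple summing operators: a continuous $m$-linear $T:E_1\times\dots\times E_m\to F$ between Banach spaces is multiple $p$-summing if there is $C>0$ such that for all finite sequences $(x^k_{j_k})_{j_k=1}^{J_k}\subset E_k$, $k=1,\dots,m$, $$\Big(\sum_{j_1,\dots,j_m}\|T(x^1_{j_1},\dots,x^m_{j_m})\|_F^p\Big)^{1/p}\le C\,w_p((x^1_{j})_{j})\cdots w_p((x^m_{j})_{j}),\qquad w_p((y_j)_j)=\sup_{\gamma\in B_{E'}}\Big(\sum_j|\gamma(y_j)|^p\Big)^{1/p}.$$ $\Pi_p(^mE;F)$ is the space of multiple $p$-summing $m$-linear maps $E\times\dots\times E\to F$. $\mathcal L_q^g$-spaces: a normed space $X$ is an $\mathcal L_{q,\lambda}^g$-space ($1\le\lambda<\infty$) if for each finite dimensional subspace $M\subset X$ and each $\varepsilon>0$ there are $k\in\mathbb N$ and linear operators $R:M\to\ell_q^k$, $S:\ell_q^k\to X$ with $S\circ R$ equal to the inclusion $M\hookrightarrow X$ and $\|S\|\,\|R\|\le\lambda+\varepsilon$. $X$ is an $\mathcal L_q^g$-space if it is an $\mathcal L_{q,\lambda}^g$-space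 for some $\lambda\ge1$. *)

theory Defs
  imports "HOL-Analysis.Analysis" "HOL-Library.Function_Algebras"
begin

text \<open>
  The scalar field is a type of class \<open>real_or_complex\<close>: up to an isometric isomorphism of real
  algebras it is one of the two fields \<open>real\<close> and \<open>complex\<close>.
\<close>

definition (in real_normed_field) isometric_field_iso :: "('a \<Rightarrow> 'b::real_normed_field) \<Rightarrow> bool" where
  "isometric_field_iso \<phi> \<longleftrightarrow>
     bij \<phi> \<and>
     (\<forall>x y. \<phi> (x + y) = \<phi> x + \<phi> y) \<and>
     (\<forall>x y. \<phi> (x * y) = \<phi> x * \<phi> y) \<and>
     (\<forall>r x. \<phi> (r *\<^sub>R x) = r *\<^sub>R \<phi> x) \<and>
     (\<forall>x. norm (\<phi> x) = norm x)"

class real_or_complex = real_normed_field +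
  assumes real_or_complex:
    "(\<exists>\<phi> :: 'a \<Rightarrow> real. isometric_field_iso \<phi>) \<or> (\<exists>\<phi> :: 'a \<Rightarrow> complex. isometric_field_iso \<phi>)"

instance real :: real_or_complex
proof
  have "isometric_field_iso (id :: real \<Rightarrow> real)"
    by (simp add: isometric_field_iso_def)
  then show "(\<exists>\<phi> :: real \<Rightarrow> real. isometric_field_iso \<phi>) \<or>
      (\<exists>\<phi> :: real \<Rightarrow> complex. isometric_field_iso \<phi>)" by blast
qed

instance complex :: real_or_complex
proof
  have "isometric_field_iso (id :: complex \<Rightarrow> complex)"
    by (simp add: isometric_field_iso_def)
  then show "(\<exists>\<phi> :: complex \<Rightarrow> real. isometric_field_iso \<phi>) \<or>
      (\<exists>\<phi> :: complex \<Rightarrow> complex. isometric_field_iso \<phi>)" by blast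
qed

text \<open>
  A normed space over the scalar field is a real normed space carrying a scalar multiplication
  that extends the real one and for which the norm is homogeneous; it is a Banach space over that
  field when its type is of class \<open>banach\<close>.
\<close>

locale normed_space_over = vector_space scale
  for scale :: "'k::real_or_complex \<Rightarrow> 'e::real_normed_vector \<Rightarrow> 'e" +
  assumes scale_of_real: "scale (of_real r) x = r *\<^sub>R x"
    and norm_scale: "norm (scale c x) = norm c * norm x"

lemma normed_space_over_real: "normed_space_over (scaleR :: real \<Rightarrow> 'e::real_normed_vector \<Rightarrow> 'e)"
  by unfold_locales (simp_all add: algebra_simps)

lemma normed_space_over_self: "normed_space_over ((*) :: 'k::real_or_complex \<Rightarrow> 'k \<Rightarrow> 'k)"
  by unfold_locales (simp_all add: algebra_simps norm_mult scaleR_conv_of_real)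


definition dual_ball :: "('k::real_or_complex \<Rightarrow> 'e::real_normed_vector \<Rightarrow> 'e) \<Rightarrow> ('e \<Rightarrow> 'k) set" where
  "dual_ball sE = {\<gamma>. Vector_Spaces.linear sE (*) \<gamma> \<and> bounded_linear \<gamma> \<and> onorm \<gamma> \<le> 1}"

definition weak_norm ::
    "('k::real_or_complex \<Rightarrow> 'e::real_normed_vector \<Rightarrow> 'e) \<Rightarrow> real \<Rightarrow> nat \<Rightarrow> (nat \<Rightarrow> 'e) \<Rightarrow> real" where
  "weak_norm sE p J y =
     (SUP \<gamma>\<in>dual_ball sE. (\<Sum>j<J. norm (\<gamma> (y j)) powr p) powr (1 / p))"

text \<open>
  An \<open>m\<close>-linear map on \<open>E \<times> \<dots> \<times> E\<close> is a function of \<open>x :: 'm \<Rightarrow> 'e\<close>, where \<open>'m\<close> is a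
  finite type with \<open>m\<close> elements. Continuity refers to the product topology on \<open>'m \<Rightarrow> 'e\<close>.
\<close>

definition multilinear ::
    "('k::real_or_complex \<Rightarrow> 'e::real_normed_vector \<Rightarrow> 'e) \<Rightarrow>
     ('k \<Rightarrow> 'f::real_normed_vector \<Rightarrow> 'f) \<Rightarrow> (('m::finite \<Rightarrow> 'e) \<Rightarrow> 'f) \<Rightarrow> bool" where
  "multilinear sE sF T \<longleftrightarrow> (\<forall>k x. Vector_Spaces.linear sE sF (\<lambda>y. T (x(k := y))))"

text \<open>
  The \<open>k\<close>-th finite sequence is \<open>x k 0, \<dots>, x k (J k - 1)\<close>, and the multi-index
  \<open>(j\<^sub>1, \<dots>, j\<^sub>m)\<close> is a function \<open>j :: 'm \<Rightarrow> nat\<close> with \<open>j k < J k\<close> for all \<open>k\<close>.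
\<close>

definition multiple_summing ::
    "('k::real_or_complex \<Rightarrow> 'e::real_normed_vector \<Rightarrow> 'e) \<Rightarrow>
     ('k \<Rightarrow> 'f::real_normed_vector \<Rightarrow> 'f) \<Rightarrow> real \<Rightarrow> (('m::finite \<Rightarrow> 'e) \<Rightarrow> 'f) set" where
  "multiple_summing sE sF p =
     {T. multilinear sE sF T \<and> continuous_on UNIV T \<and>
         (\<exists>C>0. \<forall>(J :: 'm \<Rightarrow> nat) (x :: 'm \<Rightarrow> nat \<Rightarrow> 'e).
            (\<Sum>j\<in>{j. \<forall>k. j k < J k}. norm (T (\<lambda>k. x k (j k))) powr p) powr (1 / p)
              \<le> C * (\<Prod>k\<in>UNIV. weak_norm sE p (J k) (x k)))}"

text \<open>The index set of the sum above is finite, so the sum does not degenerate.\<close>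

lemma finite_multi_indices: "finite {j :: 'm::finite \<Rightarrow> nat. \<forall>k. j k < J k}"
proof -
  have "{j :: 'm \<Rightarrow> nat. \<forall>k. j k < J k} = PiE UNIV (\<lambda>k. {..<J k})"
    by (auto simp: PiE_def)
  then show ?thesis by (simp add: finite_PiE)
qed


text \<open>
  The space \<open>\<ell>\<^sub>q\<^sup>n\<close> consists of the functions \<open>v :: nat \<Rightarrow> 'k\<close> that vanish from \<open>n\<close> on, with
  pointwise addition and scalar multiplication.
\<close>

definition lq_space :: "nat \<Rightarrow> (nat \<Rightarrow> 'k::real_or_complex) set" where
  "lq_space n = {v. \<forall>i\<ge>n. v i = 0}"

definition lq_scale :: "'k::real_or_complex \<Rightarrow> (nat \<Rightarrow> 'k) \<Rightarrow> nat \<Rightarrow> 'k" where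
  "lq_scale c v = (\<lambda>i. c * v i)"

definition lq_norm :: "real \<Rightarrow> nat \<Rightarrow> (nat \<Rightarrow> 'k::real_or_complex) \<Rightarrow> real" where
  "lq_norm q n v = (\<Sum>i<n. norm (v i) powr q) powr (1 / q)"

definition linear_on_subspace ::
    "'a::ab_group_add set \<Rightarrow> ('k \<Rightarrow> 'a \<Rightarrow> 'a) \<Rightarrow> ('k \<Rightarrow> 'b::ab_group_add \<Rightarrow> 'b) \<Rightarrow> ('a \<Rightarrow> 'b) \<Rightarrow> bool" where
  "linear_on_subspace M s1 s2 f \<longleftrightarrow>
     (\<forall>x\<in>M. \<forall>y\<in>M. f (x + y) = f x + f y) \<and> (\<forall>c. \<forall>x\<in>M. f (s1 c x) = s2 c (f x))"

text \<open>
  The operator norm of a linear map on the subspace \<open>M\<close>. It is only used for finite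
  dimensional \<open>M\<close>, where the supremum is that of a bounded set.
\<close>

definition opnorm_on :: "'a set \<Rightarrow> ('a \<Rightarrow> real) \<Rightarrow> ('b \<Rightarrow> real) \<Rightarrow> ('a \<Rightarrow> 'b) \<Rightarrow> real" where
  "opnorm_on M n1 n2 f = (SUP x\<in>{x\<in>M. n1 x \<le> 1}. n2 (f x))"

definition Lg_const_space ::
    "('k::real_or_complex \<Rightarrow> 'e::real_normed_vector \<Rightarrow> 'e) \<Rightarrow> real \<Rightarrow> real \<Rightarrow> bool" where
  "Lg_const_space sE q L \<longleftrightarrow>
     (\<forall>M \<epsilon>. module.subspace sE M \<and> (\<exists>B. finite B \<and> M = module.span sE B) \<and> \<epsilon> > 0 \<longrightarrow>
        (\<exists>n (R :: 'e \<Rightarrow> nat \<Rightarrow> 'k) (S :: (nat \<Rightarrow> 'k) \<Rightarrow> 'e).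
           R ` M \<subseteq> lq_space n \<and>
           linear_on_subspace M sE lq_scale R \<and>
           linear_on_subspace (lq_space n) lq_scale sE S \<and>
           (\<forall>x\<in>M. S (R x) = x) \<and>
           opnorm_on (lq_space n) (lq_norm q n) norm S * opnorm_on M norm (lq_norm q n) R
             \<le> L + \<epsilon>))"

definition Lg_space ::
    "('k::real_or_complex \<Rightarrow> 'e::real_normed_vector \<Rightarrow> 'e) \<Rightarrow> real \<Rightarrow> bool" where
  "Lg_space sE q \<longleftrightarrow> (\<exists>L\<ge>1. Lg_const_space sE q L)"

end

theory Submission
  imports Defs
begin

text \<open>
  The theorem follows from one inclusion: for every \<open>s > 0\<close> and every \<open>P \<ge> q\<close>, a multiple
  \<open>s\<close>-summing map is multiple \<open>P\<close>-summing (\<open>multiple_summing_subset\<close>). With \<open>s = p\<close>, \<open>P = q\<close> it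
  gives the inclusion for every \<open>p\<close>, and with \<open>s = q\<close>, \<open>P = p \<ge> q\<close> the reverse one.

  Behind it stand the moments of \<open>\<parallel>T(\<epsilon>\<^sub>1, \<dots>, \<epsilon>\<^sub>m)\<parallel>\<close>, where each argument runs over all sums
  \<open>\<Sum>\<^sub>i \<plusminus> e\<^sub>i\<close> of the unit vectors of \<open>\<ell>\<^sub>2\<^sup>n\<close>. For maps on \<open>\<ell>\<^sub>2\<^sup>n\<close> with values in \<open>\<ell>\<^sub>q\<^sup>N\<close> they are all
  equivalent, and for \<open>P \<ge> q\<close> they are also equivalent to the least constant in the definition of a
  multiple \<open>P\<close>-summing map, with bounds that depend on neither \<open>n\<close> nor \<open>N\<close>.
  The local structure of the two spaces reduces the theorem to this situation: the given vectors of
  \<open>Y\<close> factor through some \<open>\<ell>\<^sub>2\<^sup>n\<close>, the values of \<open>T\<close> on the image of \<open>\<ell>\<^sub>2\<^sup>n\<close> factor through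
  some \<open>\<ell>\<^sub>q\<^sup>N\<close>, and only the products of operator norms enter the constants.

  Three estimates are combined.

  \<^item> By Khinchine's inequality the \<open>2\<^sup>n\<close> sign sums have weak \<open>s\<close>-norm at most a constant times
    \<open>2\<^bsup>n/s\<^esup>\<close> (\<open>weak_norm_rademacher_le\<close>). Testing the hypothesis on them bounds the \<open>s\<close>-th moment
    of \<open>T\<close> over signs.

  \<^item> All moments over signs are equivalent (\<open>multilinear_kahane\<close>). In one variable and in
    \<open>\<ell>\<^sub>q\<^sup>N\<close> this follows from Khinchine and Minkowski (\<open>lq_kahane\<close>); Minkowski's inequality
    then allows to treat one variable after the other (\<open>sum_powr_tensorize\<close>).

  \<^item> For a linear map \<open>u\<close> from \<open>\<ell>\<^sub>2\<^sup>n\<close> to \<open>\<ell>\<^sub>q\<^sup>N\<close> and \<open>P \<ge> q\<close>, the sum \<open>\<Sum>\<^sub>j \<parallel>u x\<^sub>j\<parallel>\<^sup>P\<close> is at most a constant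
    times the \<open>P\<close>-th power of the weak \<open>P\<close>-norm of \<open>x\<close> times the \<open>P\<close>-th moment of \<open>u\<close> over signs (\<open>lq_summing_bound\<close>).
    Replacing in this way the vectors of one variable after the other by sign sums
    (\<open>sum_replace_coordinates\<close>) bounds the sums for \<open>T\<close> by its \<open>P\<close>-th moment.

  Two facts of functional analysis link these estimates with the definitions: linear maps on finite
  dimensional subspaces are bounded, so that the operator norms of the factorisations are genuine
  bounds, and functionals on subspaces extend by the Hahn-Banach theorem, so that weak norms can be
  computed on the subspace that carries the given vectors.
\<close>

section \<open>Inequalities for finite means\<close>

definition mean :: "'a set \<Rightarrow> ('a \<Rightarrow> real) \<Rightarrow> real" where
  "mean A f = (\<Sum>x\<in>A. f x) / real (card A)"

lemma mean_mono: "(\<And>x. x \<in> A \<Longrightarrow> f x \<le> g x) \<Longrightarrow> mean A f \<le> mean A g"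
  unfolding mean_def by (intro divide_right_mono sum_mono) auto

lemma mean_nonneg: "(\<And>x. x \<in> A \<Longrightarrow> 0 \<le> f x) \<Longrightarrow> 0 \<le> mean A f"
  unfolding mean_def by (intro divide_nonneg_nonneg sum_nonneg) auto

lemma mean_add: "mean A (\<lambda>x. f x + g x) = mean A f + mean A g"
  by (simp add: mean_def sum.distrib add_divide_distrib)

lemma mean_cmult: "mean A (\<lambda>x. c * f x) = c * mean A f"
  by (simp add: mean_def sum_distrib_left)

text \<open>
  Young's inequality for the factors \<open>z\<close> and \<open>1\<close>.
\<close>

lemma powr_above_tangent:
  fixes z r :: real
  assumes "0 \<le> z" "1 \<le> r"
  shows "r * z - r + 1 \<le> z powr r"
proof (cases "r = 1")
  case True
  then show ?thesis using assms by simp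
next
  case False
  then have r: "r > 1" using assms by simp
  have "z * 1 \<le> z powr r / r + 1 powr (r / (r - 1)) / (r / (r - 1))"
    by (rule Youngs_inequality) (use r assms in \<open>auto simp: field_simps\<close>)
  then have "r * z \<le> r * (z powr r / r + (r - 1) / r)"
    using r by (intro mult_left_mono) auto
  also have "\<dots> = z powr r + (r - 1)" using r by (simp add: distrib_left)
  finally have "r * z \<le> z powr r + (r - 1)" .
  then show ?thesis by simp
qed

text \<open>
  Jensen's inequality for \<open>x powr r\<close> on the closed half line. The weighted mean \<open>s\<close> is the point of
  tangency: averaging the tangent inequality over the values \<open>y i / s\<close> cancels the linear term.
\<close>

lemma powr_convex_sum:
  fixes a y :: "'i \<Rightarrow> real"
  assumes "finite I" "\<And>i. i \<in> I \<Longrightarrow> 0 \<le> a i" "(\<Sum>i\<in>I. a i) = 1"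
    and "\<And>i. i \<in> I \<Longrightarrow> 0 \<le> y i" "1 \<le> r"
  shows "(\<Sum>i\<in>I. a i * y i) powr r \<le> (\<Sum>i\<in>I. a i * y i powr r)"
proof -
  define s where "s = (\<Sum>i\<in>I. a i * y i)"
  have s0: "0 \<le> s" unfolding s_def using assms by (intro sum_nonneg mult_nonneg_nonneg) auto
  show ?thesis
  proof (cases "s = 0")
    case True
    then show ?thesis using assms unfolding s_def[symmetric] by (auto intro!: sum_nonneg)
  next
    case False
    then have s: "s > 0" using s0 by simp
    have "1 = r * (s / s) + (1 - r) * 1" using s by simp
    also have "\<dots> = r * ((\<Sum>i\<in>I. a i * y i) / s) + (1 - r) * (\<Sum>i\<in>I. a i)"
      using assms(3) by (simp add: s_def)
    also have "\<dots> = (\<Sum>i\<in>I. a i * (r * (y i / s) - r + 1))"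
      by (simp add: sum_divide_distrib sum_distrib_left flip: sum.distrib) (simp add: algebra_simps)
    also have "\<dots> \<le> (\<Sum>i\<in>I. a i * (y i / s) powr r)"
      using assms s by (intro sum_mono mult_left_mono powr_above_tangent) auto
    also have "\<dots> = (\<Sum>i\<in>I. a i * y i powr r) / s powr r"
      by (simp add: powr_divide sum_divide_distrib)
    finally show ?thesis using s by (simp add: s_def field_simps)
  qed
qed

text \<open>
  Minkowski's inequality: the sequence of sums over \<open>i\<close>, divided by the sum of the norms, is a convex
  combination of sequences of norm one, so the convexity of the power bounds its norm by one.
\<close>

lemma minkowski_powr:
  fixes h :: "'i \<Rightarrow> 'j \<Rightarrow> real"
  assumes "finite I" "finite J" "\<And>i j. i \<in> I \<Longrightarrow> j \<in> J \<Longrightarrow> 0 \<le> h i j" "1 \<le> r"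
  shows "(\<Sum>j\<in>J. (\<Sum>i\<in>I. h i j) powr r) \<le> (\<Sum>i\<in>I. (\<Sum>j\<in>J. h i j powr r) powr (1 / r)) powr r"
proof -
  define nrm where "nrm i = (\<Sum>j\<in>J. h i j powr r) powr (1 / r)" for i
  define total where "total = (\<Sum>i\<in>I. nrm i)"
  have nn: "0 \<le> nrm i" for i by (simp add: nrm_def)
  have nr: "nrm i powr r = (\<Sum>j\<in>J. h i j powr r)" for i
    using assms by (simp add: nrm_def powr_powr sum_nonneg)
  \<comment> \<open>hence the quotients by \<open>nrm i\<close> below are correct also where it vanishes, with \<open>0 / 0 = 0\<close>\<close>
  have hz: "h i j = 0" if "nrm i = 0" "i \<in> I" "j \<in> J" for i j
  proof -
    have "(\<Sum>j\<in>J. h i j powr r) = 0" using nr[of i] that assms by simp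
    then show ?thesis using assms that by (simp add: sum_nonneg_eq_0_iff)
  qed
  show ?thesis
  proof (cases "total = 0")
    case True
    then have "\<forall>i\<in>I. nrm i = 0" using nn assms by (simp add: total_def sum_nonneg_eq_0_iff)
    then have "(\<Sum>j\<in>J. (\<Sum>i\<in>I. h i j) powr r) = 0" using hz assms by simp
    then show ?thesis by simp
  next
    case False
    then have t: "total > 0" using nn sum_nonneg[of I nrm] by (simp add: total_def)
    have w: "(\<Sum>i\<in>I. nrm i / total) = 1"
      using t by (simp add: total_def flip: sum_divide_distrib)
    have "(\<Sum>j\<in>J. (\<Sum>i\<in>I. h i j) powr r) = total powr r * (\<Sum>j\<in>J. (\<Sum>i\<in>I. nrm i / total * (h i j / nrm i)) powr r)"
    proof -
      have "(\<Sum>i\<in>I. h i j) powr r = total powr r * (\<Sum>i\<in>I. nrm i / total * (h i j / nrm i)) powr r" if "j \<in> J" for j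
      proof -
        have "(\<Sum>i\<in>I. nrm i / total * (h i j / nrm i)) = (\<Sum>i\<in>I. h i j / total)"
          using hz that by (intro sum.cong) auto
        also have "\<dots> = (\<Sum>i\<in>I. h i j) / total" by (simp add: sum_divide_distrib)
        finally show ?thesis using t assms that
          by (simp add: powr_divide sum_nonneg)
      qed
      then show ?thesis by (simp add: sum_distrib_left)
    qed
    also have "\<dots> \<le> total powr r * (\<Sum>j\<in>J. \<Sum>i\<in>I. nrm i / total * (h i j / nrm i) powr r)"
      using assms t nn w by (intro mult_left_mono sum_mono powr_convex_sum) auto
    also have "\<dots> = total powr r * (\<Sum>i\<in>I. nrm i / total * (\<Sum>j\<in>J. (h i j / nrm i) powr r))"
      by (subst sum.swap) (simp add: sum_distrib_left)
    also have "\<dots> \<le> total powr r * (\<Sum>i\<in>I. nrm i / total * 1)"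
    proof -
      have "(\<Sum>j\<in>J. (h i j / nrm i) powr r) \<le> 1" if "i \<in> I" for i
      proof -
        have "(\<Sum>j\<in>J. (h i j / nrm i) powr r) = (\<Sum>j\<in>J. h i j powr r / nrm i powr r)"
          using that assms nn by (intro sum.cong) (auto simp: powr_divide)
        also have "\<dots> = nrm i powr r / nrm i powr r" by (simp only: nr sum_divide_distrib)
        also have "\<dots> \<le> 1" by simp
        finally show ?thesis .
      qed
      then show ?thesis using nn t
        by (intro mult_left_mono sum_mono) auto
    qed
    also have "\<dots> = total powr r" using w by simp
    finally show ?thesis by (simp add: total_def nrm_def)
  qed
qed

lemma power_mean_le:
  assumes "finite A" "A \<noteq> {}" "\<And>x. x \<in> A \<Longrightarrow> 0 \<le> f x" "0 < p" "p \<le> s"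
  shows "mean A (\<lambda>x. f x powr p) \<le> (mean A (\<lambda>x. f x powr s)) powr (p / s)"
proof -
  define N where "N = real (card A)"
  have N: "N > 0" using assms by (simp add: N_def card_gt_0_iff)
  have "(\<Sum>x\<in>A. 1 / N * f x powr p) powr (s / p) \<le> (\<Sum>x\<in>A. 1 / N * (f x powr p) powr (s / p))"
    using assms N by (intro powr_convex_sum) (auto simp: N_def)
  also have "\<dots> = mean A (\<lambda>x. f x powr s)"
    using assms by (simp add: mean_def N_def powr_powr sum_divide_distrib)
  also have "(\<Sum>x\<in>A. 1 / N * f x powr p) = mean A (\<lambda>x. f x powr p)"
    by (simp add: mean_def N_def sum_divide_distrib)
  finally have "(mean A (\<lambda>x. f x powr p) powr (s / p)) powr (p / s) \<le> (mean A (\<lambda>x. f x powr s)) powr (p / s)"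
    using assms by (intro powr_mono2) auto
  then show ?thesis using assms
    by (simp add: powr_powr mean_nonneg)
qed

text \<open>
  A moment inequality between the exponents \<open>q < P\<close> propagates downwards: values above a multiple \<open>D\<close> of
  the \<open>q\<close>-norm contribute little to the \<open>q\<close>-th moment, because the \<open>P\<close>-th moment controls them, and
  below that level the \<open>q\<close>-th power is dominated by the \<open>s\<close>-th power.
\<close>

lemma reverse_power_mean:
  fixes s q P K :: real
  assumes "0 < s" "s < q" "q < P" "0 < K"
  obtains C where "C > 0"
    "\<And>(A :: 'a set) f. \<lbrakk>\<And>x. x \<in> A \<Longrightarrow> 0 \<le> f x;
        mean A (\<lambda>x. f x powr P) \<le> K * mean A (\<lambda>x. f x powr q) powr (P / q)\<rbrakk>
       \<Longrightarrow> mean A (\<lambda>x. f x powr q) \<le> C * mean A (\<lambda>x. f x powr s) powr (q / s)"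
proof -
  \<comment> \<open>relative to the \<open>q\<close>-norm, the level above which the values carry at most half of the \<open>q\<close>-th moment\<close>
  define D where "D = (2 * K) powr (1 / (P - q))"
  have D: "D > 0" using assms by (simp add: D_def)
  have DK: "D powr (q - P) * K = 1 / 2"
  proof -
    have "(q - P) / (P - q) = - 1" using assms by (simp add: divide_eq_eq)
    then have "D powr (q - P) = (2 * K) powr (- 1)"
      unfolding D_def powr_powr by simp
    then show ?thesis using assms by (simp add: powr_minus field_simps)
  qed
  define C where "C = (2 * D powr (q - s)) powr (q / s)"
  show thesis
  proof (rule that[of C])
    show "C > 0" using D by (simp add: C_def)
    fix A :: "'a set" and f :: "'a \<Rightarrow> real"
    assume f0: "\<And>x. x \<in> A \<Longrightarrow> 0 \<le> f x"
      and hyp: "mean A (\<lambda>x. f x powr P) \<le> K * mean A (\<lambda>x. f x powr q) powr (P / q)"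
    define M where "M = mean A (\<lambda>x. f x powr q)"
    have M0: "M \<ge> 0" unfolding M_def by (rule mean_nonneg) auto
    show "mean A (\<lambda>x. f x powr q) \<le> C * mean A (\<lambda>x. f x powr s) powr (q / s)"
    proof (cases "M = 0")
      case True
      then show ?thesis using \<open>C > 0\<close> by (simp add: M_def mean_nonneg)
    next
      case False
      then have M: "M > 0" using M0 by simp
      define m where "m = M powr (1 / q)"
      have m: "m > 0" using M by (simp add: m_def)
      have mq: "m powr q = M" using M assms by (simp add: m_def powr_powr)
      have mP: "m powr P = M powr (P / q)" by (simp add: m_def powr_powr)
      define E where "E = D * m"
      have E: "E > 0" using D m by (simp add: E_def)
      have pw: "f x powr q \<le> E powr (q - s) * f x powr s + E powr (q - P) * f x powr P" if "x \<in> A" for x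
      proof (cases "f x \<le> E")
        case True
        have "f x powr q = f x powr (q - s) * f x powr s" by (simp flip: powr_add)
        also have "\<dots> \<le> E powr (q - s) * f x powr s"
          using True f0[OF that] assms by (intro mult_right_mono powr_mono2) auto
        finally show ?thesis by (simp add: add_increasing2)
      next
        case False
        have "f x powr q = f x powr (q - P) * f x powr P" by (simp flip: powr_add)
        also have "\<dots> \<le> E powr (q - P) * f x powr P"
          using False E assms by (intro mult_right_mono powr_mono2') auto
        finally show ?thesis by (simp add: add_increasing)
      qed
      have "M \<le> mean A (\<lambda>x. E powr (q - s) * f x powr s + E powr (q - P) * f x powr P)"
        unfolding M_def by (rule mean_mono) (rule pw)
      also have "\<dots> = E powr (q - s) * mean A (\<lambda>x. f x powr s) + E powr (q - P) * mean A (\<lambda>x. f x powr P)"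
        by (simp add: mean_add mean_cmult)
      also have "E powr (q - P) * mean A (\<lambda>x. f x powr P) \<le> E powr (q - P) * (K * m powr P)"
        using hyp by (intro mult_left_mono) (auto simp: M_def mP)
      also have "E powr (q - P) * (K * m powr P) = (D powr (q - P) * K) * (m powr (q - P) * m powr P)"
        using D m by (simp add: E_def powr_mult)
      also have "\<dots> = M / 2" using mq by (simp add: DK flip: powr_add)
      finally have "M \<le> 2 * (E powr (q - s) * mean A (\<lambda>x. f x powr s))" by simp
      also have "\<dots> = 2 * D powr (q - s) * (m powr q / m powr s) * mean A (\<lambda>x. f x powr s)"
        using D m by (simp add: E_def powr_mult powr_diff)
      finally have "m powr s * M \<le> M * (2 * D powr (q - s) * mean A (\<lambda>x. f x powr s))"
        using m mq by (simp add: field_simps)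
      then have "m powr s \<le> 2 * D powr (q - s) * mean A (\<lambda>x. f x powr s)"
        using M by (simp add: mult.commute[of _ M])
      then have "(m powr s) powr (q / s) \<le> (2 * D powr (q - s) * mean A (\<lambda>x. f x powr s)) powr (q / s)"
        using assms by (intro powr_mono2) auto
      then show ?thesis using assms mq
        by (simp add: powr_powr C_def powr_mult mean_nonneg M_def)
    qed
  qed
qed

section \<open>Khinchine's inequality\<close>

text \<open>
  The first \<open>2\<^sup>n\<close> indices \<open>j\<close> enumerate the sign vectors of length \<open>n\<close> through the binary digits of \<open>j\<close>:
  means over \<open>j < 2\<^sup>n\<close> are expectations over \<open>n\<close> independent signs, and the indices are those of
  the finite sequences in the definition of summing maps.
\<close>

definition rad :: "nat \<Rightarrow> nat \<Rightarrow> real" where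
  "rad j i = (if odd (j div 2 ^ i) then - 1 else 1)"

text \<open>
  Conditioning on the last sign: the leading binary digit splits the range of \<open>j\<close> into two halves.
\<close>

lemma rad_sum_Suc:
  fixes a :: "nat \<Rightarrow> 'v::real_vector" and F :: "'v \<Rightarrow> real"
  shows "(\<Sum>j<2 ^ Suc n. F (\<Sum>i<Suc n. rad j i *\<^sub>R a i)) =
    (\<Sum>j<2 ^ n. F ((\<Sum>i<n. rad j i *\<^sub>R a i) + a n) + F ((\<Sum>i<n. rad j i *\<^sub>R a i) - a n))"
proof -
  let ?G = "\<lambda>j. F (\<Sum>i<Suc n. rad j i *\<^sub>R a i)"
  have "(\<Sum>j<2 ^ Suc n. ?G j) = (\<Sum>j<2 ^ n + 2 ^ n. ?G j)" by (simp add: mult_2)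
  also have "\<dots> = (\<Sum>j<2 ^ n. ?G j) + (\<Sum>j<2 ^ n. ?G (2 ^ n + j))"
  proof -
    have "(\<Sum>j<m + k. ?G j) = (\<Sum>j<m. ?G j) + (\<Sum>j<k. ?G (m + j))" for m k
      by (induction k) (auto simp: add.assoc)
    then show ?thesis .
  qed
  also have "(\<Sum>j<2 ^ n. ?G j) = (\<Sum>j<2 ^ n. F ((\<Sum>i<n. rad j i *\<^sub>R a i) + a n))"
    by (intro sum.cong) (auto simp: rad_def)
  also have "(\<Sum>j<2 ^ n. ?G (2 ^ n + j)) = (\<Sum>j<2 ^ n. F ((\<Sum>i<n. rad j i *\<^sub>R a i) - a n))"
  proof (rule sum.cong)
    fix j :: nat assume j: "j \<in> {..<2 ^ n}"
    have low: "rad (2 ^ n + j) i = rad j i" if "i < n" for i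
    proof -
      have "(2::nat) ^ n = 2 ^ i * 2 ^ (n - i)" using that by (simp flip: power_add)
      then have "(2 ^ n + j) div 2 ^ i = 2 ^ (n - i) + j div 2 ^ i" by simp
      then show ?thesis using that by (simp add: rad_def)
    qed
    have "(2 ^ n + j) div 2 ^ n = 1" using j by simp
    then have "rad (2 ^ n + j) n = - 1" by (simp add: rad_def)
    then show "?G (2 ^ n + j) = F ((\<Sum>i<n. rad j i *\<^sub>R a i) - a n)"
      using low by simp
  qed simp
  finally show ?thesis by (simp add: sum.distrib)
qed

lemma exp_add_exp_minus_le: "exp t + exp (- t) \<le> 2 * exp (t\<^sup>2)" for t :: real
proof -
  have pos: "exp t + exp (- t) \<le> 2 * exp (t\<^sup>2)" if "t \<ge> 0" for t :: real
  proof (cases "t \<le> 1")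
    case True
    have "exp t \<le> 1 + t + t\<^sup>2" using exp_bound[of t] that True by simp
    moreover have "exp (- t) \<le> 1 - t + t\<^sup>2"
    proof -
      have "1 + t + t\<^sup>2 / 2 \<le> exp t" using exp_lower_Taylor_quadratic[of t] that by simp
      moreover have "1 \<le> (1 - t + t\<^sup>2) * (1 + t + t\<^sup>2 / 2)"
      proof -
        have "(1 - t + t\<^sup>2) * (1 + t + t\<^sup>2 / 2) = 1 + t\<^sup>2 / 2 + t ^ 3 / 2 + t ^ 4 / 2"
          by (simp add: power2_eq_square power3_eq_cube power4_eq_xxxx field_simps)
        then show ?thesis using that by simp
      qed
      moreover have "0 \<le> 1 - t + t\<^sup>2" using True that by simp
      ultimately have "1 \<le> (1 - t + t\<^sup>2) * exp t"
        by (meson mult_left_mono order_trans)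
      then show ?thesis by (simp add: exp_minus field_simps)
    qed
    moreover have "1 + t\<^sup>2 \<le> exp (t\<^sup>2)" by (rule exp_ge_add_one_self)
    ultimately show ?thesis by linarith
  next
    case False
    then have "t \<le> t\<^sup>2" by (simp add: power2_eq_square)
    then have "exp t \<le> exp (t\<^sup>2)" "exp (- t) \<le> exp (t\<^sup>2)" using False by auto
    then show ?thesis by linarith
  qed
  show ?thesis using pos[of t] pos[of "- t"] by (cases "t \<ge> 0") auto
qed

text \<open>
  By independence the exponential moment is the product of the values of \<open>cosh\<close>; each is at most
  \<open>exp (a\<^sup>2)\<close>.
\<close>

lemma rad_exp_moment:
  fixes a :: "nat \<Rightarrow> real"
  shows "(\<Sum>j<2 ^ n. exp (\<Sum>i<n. rad j i *\<^sub>R a i)) \<le> 2 ^ n * exp (\<Sum>i<n. (a i)\<^sup>2)"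
proof (induction n)
  case 0
  then show ?case by simp
next
  case (Suc n)
  let ?S = "\<lambda>j. \<Sum>i<n. rad j i *\<^sub>R a i"
  have "(\<Sum>j<2 ^ Suc n. exp (\<Sum>i<Suc n. rad j i *\<^sub>R a i)) = (\<Sum>j<2 ^ n. exp (?S j + a n) + exp (?S j - a n))"
    by (rule rad_sum_Suc)
  also have "\<dots> = (\<Sum>j<2 ^ n. exp (?S j)) * (exp (a n) + exp (- a n))"
    by (simp add: sum_distrib_right sum.distrib distrib_left exp_add exp_diff exp_minus divide_inverse)
  also have "\<dots> \<le> (2 ^ n * exp (\<Sum>i<n. (a i)\<^sup>2)) * (2 * exp ((a n)\<^sup>2))"
    using Suc exp_add_exp_minus_le[of "a n"] by (intro mult_mono) (auto intro: sum_nonneg)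
  finally show ?case by (simp add: exp_add)
qed

lemma rad_second_moment_real:
  fixes a :: "nat \<Rightarrow> real"
  shows "(\<Sum>j<2 ^ n. (\<Sum>i<n. rad j i *\<^sub>R a i)\<^sup>2) = 2 ^ n * (\<Sum>i<n. (a i)\<^sup>2)"
proof (induction n)
  case 0
  then show ?case by simp
next
  case (Suc n)
  let ?S = "\<lambda>j. \<Sum>i<n. rad j i *\<^sub>R a i"
  have "(\<Sum>j<2 ^ Suc n. (\<Sum>i<Suc n. rad j i *\<^sub>R a i)\<^sup>2) = (\<Sum>j<2 ^ n. (?S j + a n)\<^sup>2 + (?S j - a n)\<^sup>2)"
    by (rule rad_sum_Suc)
  also have "\<dots> = (\<Sum>j<2 ^ n. 2 * (?S j)\<^sup>2 + 2 * (a n)\<^sup>2)"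
    by (intro sum.cong) (auto simp: power2_eq_square algebra_simps)
  also have "\<dots> = 2 * (\<Sum>j<2 ^ n. (?S j)\<^sup>2) + 2 ^ Suc n * (a n)\<^sup>2"
    by (simp add: sum.distrib sum_distrib_left)
  finally show ?case using Suc by (simp add: algebra_simps)
qed

text \<open>
  This allows to treat the two scalar fields at once: over the reals the imaginary part is zero.
\<close>

lemma real_imaginary_parts:
  obtains re im :: "'k::real_or_complex \<Rightarrow> real"
  where "linear re" "linear im" "\<And>z. (norm z)\<^sup>2 = (re z)\<^sup>2 + (im z)\<^sup>2"
proof -
  consider (real) \<phi> :: "'k \<Rightarrow> real" where "isometric_field_iso \<phi>"
    | (complex) \<phi> :: "'k \<Rightarrow> complex" where "isometric_field_iso \<phi>"
    using real_or_complex by blast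
  then show thesis
  proof cases
    case real
    have "linear \<phi>" using real by (intro linearI) (auto simp: isometric_field_iso_def)
    moreover have "norm z = \<bar>\<phi> z\<bar>" for z
      using real unfolding isometric_field_iso_def by (metis real_norm_def)
    ultimately show thesis by (intro that[of \<phi> "\<lambda>_. 0"]) (auto intro: linearI)
  next
    case complex
    have "linear (\<lambda>z. Re (\<phi> z))" "linear (\<lambda>z. Im (\<phi> z))"
      using complex by (auto intro!: linearI simp: isometric_field_iso_def)
    moreover have "norm z = cmod (\<phi> z)" for z
      using complex unfolding isometric_field_iso_def by metis
    ultimately show thesis by (intro that) (auto simp: cmod_power2)
  qed
qed

lemma lq_norm_two: "lq_norm 2 n v = sqrt (\<Sum>i<n. (norm (v i))\<^sup>2)"
  by (simp add: lq_norm_def powr_half_sqrt sum_nonneg)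

lemma lq_norm_nonneg [simp]: "0 \<le> lq_norm q n v"
  by (simp add: lq_norm_def)

lemma lq_norm_powr: "0 < q \<Longrightarrow> lq_norm q n v powr q = (\<Sum>i<n. norm (v i) powr q)"
  by (simp add: lq_norm_def powr_powr sum_nonneg)

lemma rad_second_moment:
  fixes a :: "nat \<Rightarrow> 'k::real_or_complex"
  shows "mean {..<2 ^ n} (\<lambda>j. norm (\<Sum>i<n. rad j i *\<^sub>R a i) powr 2) = (lq_norm 2 n a)\<^sup>2"
proof -
  obtain re im :: "'k \<Rightarrow> real" where ri: "linear re" "linear im" "\<And>z. (norm z)\<^sup>2 = (re z)\<^sup>2 + (im z)\<^sup>2"
    using real_imaginary_parts by blast
  have *: "f (\<Sum>i<n. rad j i *\<^sub>R a i) = (\<Sum>i<n. rad j i *\<^sub>R f (a i))" if "linear f" for f :: "'k \<Rightarrow> real" and j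
    using that by (simp add: linear_sum linear_scale)
  have "(\<Sum>j<2 ^ n. norm (\<Sum>i<n. rad j i *\<^sub>R a i) powr 2) = 2 ^ n * (\<Sum>i<n. (norm (a i))\<^sup>2)"
    by (simp add: ri(3) *[OF ri(1)] *[OF ri(2)] sum.distrib distrib_left
        rad_second_moment_real[unfolded real_scaleR_def])
  then show ?thesis by (simp add: mean_def lq_norm_two sum_nonneg)
qed

text \<open>
  The function \<open>p ln x - x\<close> is largest at \<open>x = p\<close>.
\<close>

lemma powr_le_exp: "x powr p \<le> p powr p * exp x" if "0 \<le> x" "0 < p" for x p :: real
proof (cases "x = 0")
  case False
  then have x: "x > 0" using that by simp
  have "ln (x / p) \<le> x / p - 1" using x that by (intro ln_le_minus_one) auto
  then have "p * ln (x / p) \<le> p * (x / p - 1)" using that by (intro mult_left_mono) auto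
  then have "p * ln x \<le> p * ln p + x" using x that by (simp add: ln_div algebra_simps)
  then have "exp (p * ln x) \<le> exp (p * ln p) * exp x" by (simp flip: exp_add)
  then show ?thesis using x that by (simp add: powr_def)
qed (use that in auto)

text \<open>
  Once the coefficients have \<open>\<ell>\<^sub>2\<close>-norm one, the real and imaginary parts of the sum have bounded
  exponential moments, and these dominate every power.
\<close>

lemma khinchine_upper:
  fixes p :: real
  assumes "0 < p"
  obtains B where "B > 0"
    "\<And>n (a :: nat \<Rightarrow> 'k::real_or_complex).
       mean {..<2 ^ n} (\<lambda>j. norm (\<Sum>i<n. rad j i *\<^sub>R a i) powr p) \<le> B * lq_norm 2 n a powr p"
proof -
  obtain re im :: "'k \<Rightarrow> real" where ri: "linear re" "linear im" "\<And>z. (norm z)\<^sup>2 = (re z)\<^sup>2 + (im z)\<^sup>2"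
    using real_imaginary_parts by blast
  have re_le: "\<bar>re z\<bar> \<le> norm z" and im_le: "\<bar>im z\<bar> \<le> norm z" for z
    using ri(3)[of z] by (auto intro!: abs_le_square_iff[THEN iffD2, of _ "norm z", simplified])
  have tri: "norm z \<le> \<bar>re z\<bar> + \<bar>im z\<bar>" for z
  proof (rule power2_le_imp_le)
    show "(norm z)\<^sup>2 \<le> (\<bar>re z\<bar> + \<bar>im z\<bar>)\<^sup>2" by (simp add: ri(3) power2_sum)
  qed simp
  have exp_abs: "exp \<bar>t\<bar> \<le> exp t + exp (- t)" for t :: real
    by (cases "t \<ge> 0") (auto simp: add_increasing add_increasing2)
  \<comment> \<open>each of the four exponentials below has mean at most \<open>exp 4\<close>, because of the factor two in its exponent\<close>
  define B where "B = p powr p * (4 * exp 4)"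
  show thesis
  proof (rule that[of B])
    show "B > 0" using assms by (simp add: B_def)
    fix n and a :: "nat \<Rightarrow> 'k"
    define \<sigma> where "\<sigma> = lq_norm 2 n a"
    have s2: "\<sigma>\<^sup>2 = (\<Sum>i<n. (norm (a i))\<^sup>2)" by (simp add: \<sigma>_def lq_norm_two sum_nonneg)
    show "mean {..<2 ^ n} (\<lambda>j. norm (\<Sum>i<n. rad j i *\<^sub>R a i) powr p) \<le> B * lq_norm 2 n a powr p"
    proof (cases "\<sigma> = 0")
      case True
      then have "\<forall>i<n. a i = 0" using s2 by (simp add: sum_nonneg_eq_0_iff)
      then show ?thesis using \<open>B > 0\<close> assms by (simp add: mean_def)
    next
      case False
      then have s: "\<sigma> > 0" using lq_norm_nonneg[of 2 n a] unfolding \<sigma>_def by linarith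
      define b where "b i = a i /\<^sub>R \<sigma>" for i
      have b2: "(\<Sum>i<n. (norm (b i))\<^sup>2) = 1"
      proof -
        have "(\<Sum>i<n. (norm (b i))\<^sup>2) = (\<Sum>i<n. (norm (a i))\<^sup>2 / \<sigma>\<^sup>2)"
          using s by (simp add: b_def power_mult_distrib power_inverse divide_inverse mult.commute)
        also have "\<dots> = \<sigma>\<^sup>2 / \<sigma>\<^sup>2" by (simp only: s2 sum_divide_distrib)
        finally show ?thesis using s by simp
      qed
      define S where "S j = (\<Sum>i<n. rad j i *\<^sub>R b i)" for j
      have lin: "f (S j) = (\<Sum>i<n. rad j i *\<^sub>R f (b i))" if "linear f" for f :: "'k \<Rightarrow> real" and j
        using that by (simp add: linear_sum linear_scale S_def)
      have expm: "(\<Sum>j<2 ^ n. exp (c * f (S j))) \<le> 2 ^ n * exp 4"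
        if "linear f" "\<And>z. \<bar>f z\<bar> \<le> norm z" "\<bar>c\<bar> = 2" for f c
      proof -
        have "(\<Sum>j<2 ^ n. exp (c * f (S j))) = (\<Sum>j<2 ^ n. exp (\<Sum>i<n. rad j i *\<^sub>R (c * f (b i))))"
          by (simp add: lin[OF that(1)] sum_distrib_left algebra_simps)
        also have "\<dots> \<le> 2 ^ n * exp (\<Sum>i<n. (c * f (b i))\<^sup>2)" by (rule rad_exp_moment)
        also have "(\<Sum>i<n. (c * f (b i))\<^sup>2) \<le> (\<Sum>i<n. 4 * (norm (b i))\<^sup>2)"
        proof (rule sum_mono)
          fix i
          have "c\<^sup>2 = 4" using that(3) by (metis abs_power2 numeral_2_eq_2 power2_abs power2_eq_square mult_2 numeral_Bit0)
          then show "(c * f (b i))\<^sup>2 \<le> 4 * (norm (b i))\<^sup>2"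
            using that(2)[of "b i"] by (simp add: power_mult_distrib abs_le_square_iff[symmetric])
        qed
        also have "\<dots> = 4" using b2 by (simp flip: sum_distrib_left)
        finally show ?thesis by simp
      qed
      have "norm (S j) powr p \<le> p powr p * (exp (2 * re (S j)) + exp (- 2 * re (S j)) + (exp (2 * im (S j)) + exp (- 2 * im (S j))))" for j
      proof -
        let ?x = "\<bar>re (S j)\<bar>" and ?y = "\<bar>im (S j)\<bar>"
        have "exp (norm (S j)) \<le> exp ?x * exp ?y" using tri by (simp flip: exp_add)
        also have "\<dots> \<le> (exp ?x)\<^sup>2 + (exp ?y)\<^sup>2"
        proof -
          have "0 \<le> exp ?x * exp ?y" by simp
          then show ?thesis using sum_squares_bound[of "exp ?x" "exp ?y"] unfolding mult.assoc by linarith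
        qed
        also have "\<dots> = exp \<bar>2 * re (S j)\<bar> + exp \<bar>2 * im (S j)\<bar>"
          by (simp add: abs_mult exp_double)
        also have "\<dots> \<le> (exp (2 * re (S j)) + exp (- 2 * re (S j)) + (exp (2 * im (S j)) + exp (- 2 * im (S j))))"
          using exp_abs[of "2 * re (S j)"] exp_abs[of "2 * im (S j)"] by simp
        finally have "exp (norm (S j)) \<le> \<dots>" .
        then show ?thesis
          by (intro order_trans[OF powr_le_exp mult_left_mono]) (use assms in auto)
      qed
      then have "(\<Sum>j<2 ^ n. norm (S j) powr p) \<le> (\<Sum>j<2 ^ n. p powr p * (exp (2 * re (S j)) + exp (- 2 * re (S j)) + (exp (2 * im (S j)) + exp (- 2 * im (S j)))))"
        by (intro sum_mono) blast
      also have "\<dots> = p powr p * ((\<Sum>j<2 ^ n. exp (2 * re (S j))) + (\<Sum>j<2 ^ n. exp (- 2 * re (S j))) + ((\<Sum>j<2 ^ n. exp (2 * im (S j))) + (\<Sum>j<2 ^ n. exp (- 2 * im (S j)))))"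
        by (simp only: sum.distrib flip: sum_distrib_left)
      also have "\<dots> \<le> p powr p * ((2 ^ n * exp 4 + 2 ^ n * exp 4) + (2 ^ n * exp 4 + 2 ^ n * exp 4))"
        using re_le im_le ri by (intro mult_left_mono add_mono expm) auto
      also have "\<dots> = 2 ^ n * B" by (simp add: B_def)
      finally have main: "(\<Sum>j<2 ^ n. norm (S j) powr p) \<le> 2 ^ n * B" .
      have "(\<Sum>i<n. rad j i *\<^sub>R a i) = \<sigma> *\<^sub>R S j" for j
        using s unfolding S_def b_def scaleR_sum_right by (intro sum.cong) (auto simp: field_simps)
      then have "mean {..<2 ^ n} (\<lambda>j. norm (\<Sum>i<n. rad j i *\<^sub>R a i) powr p) = mean {..<2 ^ n} (\<lambda>j. \<sigma> powr p * norm (S j) powr p)"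
        using s by (simp add: powr_mult)
      also have "\<dots> = \<sigma> powr p * mean {..<2 ^ n} (\<lambda>j. norm (S j) powr p)" by (rule mean_cmult)
      also have "\<dots> \<le> \<sigma> powr p * B"
        using main by (intro mult_left_mono) (auto simp: mean_def divide_le_eq mult.commute)
      finally show ?thesis by (simp add: \<sigma>_def mult.commute)
    qed
  qed
qed

text \<open>
  The second moment equals the square of the \<open>\<ell>\<^sub>2\<close>-norm exactly. For exponents below two the upper
  inequality for the fourth moment is turned into a lower one, for the others the means increase.
\<close>

lemma khinchine_lower:
  fixes q :: real
  assumes "0 < q"
  obtains A where "A > 0"
    "\<And>n (a :: nat \<Rightarrow> 'k::real_or_complex).
       lq_norm 2 n a powr q \<le> A * mean {..<2 ^ n} (\<lambda>j. norm (\<Sum>i<n. rad j i *\<^sub>R a i) powr q)"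
proof -
  have "\<exists>C>0. \<forall>n (a :: nat \<Rightarrow> 'k). mean {..<2 ^ n} (\<lambda>j. norm (\<Sum>i<n. rad j i *\<^sub>R a i) powr 2)
    \<le> C * mean {..<2 ^ n} (\<lambda>j. norm (\<Sum>i<n. rad j i *\<^sub>R a i) powr q) powr (2 / q)"
  proof (cases "q < 2")
    case True
    obtain B where B: "B > 0" "\<And>n (a :: nat \<Rightarrow> 'k).
       mean {..<2 ^ n} (\<lambda>j. norm (\<Sum>i<n. rad j i *\<^sub>R a i) powr 4) \<le> B * lq_norm 2 n a powr 4"
      using khinchine_upper[of 4] by auto
    obtain C where C: "C > 0" "\<And>A f. \<lbrakk>\<And>x :: nat. x \<in> A \<Longrightarrow> 0 \<le> f x;
        mean A (\<lambda>x. f x powr 4) \<le> B * mean A (\<lambda>x. f x powr 2) powr (4 / 2)\<rbrakk>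
       \<Longrightarrow> mean A (\<lambda>x. f x powr 2) \<le> C * mean A (\<lambda>x. f x powr q) powr (2 / q)"
      using reverse_power_mean[of q 2 4 B] True assms B(1) by auto
    show ?thesis
    proof (intro exI[of _ C] conjI allI)
      fix n and a :: "nat \<Rightarrow> 'k"
      show "mean {..<2 ^ n} (\<lambda>j. norm (\<Sum>i<n. rad j i *\<^sub>R a i) powr 2)
        \<le> C * mean {..<2 ^ n} (\<lambda>j. norm (\<Sum>i<n. rad j i *\<^sub>R a i) powr q) powr (2 / q)"
      proof (rule C(2))
        have "((lq_norm 2 n a)\<^sup>2) powr (4 / 2) = lq_norm 2 n a powr 4"
          using powr_powr[of "lq_norm 2 n a" 2 2] by simp
        then show "mean {..<2 ^ n} (\<lambda>j. norm (\<Sum>i<n. rad j i *\<^sub>R a i) powr 4)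
           \<le> B * mean {..<2 ^ n} (\<lambda>j. norm (\<Sum>i<n. rad j i *\<^sub>R a i) powr 2) powr (4 / 2)"
          using B(2)[where n=n and a=a] unfolding rad_second_moment by metis
      qed simp
    qed (rule C)
  next
    case False
    have "mean {..<2 ^ n} (\<lambda>j. norm (\<Sum>i<n. rad j i *\<^sub>R a i) powr 2)
        \<le> mean {..<2 ^ n} (\<lambda>j. norm (\<Sum>i<n. rad j i *\<^sub>R a i) powr q) powr (2 / q)" for n and a :: "nat \<Rightarrow> 'k"
      using False by (intro power_mean_le) (auto simp: lessThan_empty_iff)
    then show ?thesis by (intro exI[of _ 1]) auto
  qed
  then obtain C where C: "C > 0" "\<And>n (a :: nat \<Rightarrow> 'k). (lq_norm 2 n a)\<^sup>2
    \<le> C * mean {..<2 ^ n} (\<lambda>j. norm (\<Sum>i<n. rad j i *\<^sub>R a i) powr q) powr (2 / q)"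
    unfolding rad_second_moment by blast
  show thesis
  proof (rule that[of "C powr (q / 2)"])
    show "C powr (q / 2) > 0" using C by simp
    fix n and a :: "nat \<Rightarrow> 'k"
    let ?M = "mean {..<2 ^ n} (\<lambda>j. norm (\<Sum>i<n. rad j i *\<^sub>R a i) powr q)"
    have "((lq_norm 2 n a)\<^sup>2) powr (q / 2) \<le> (C * ?M powr (2 / q)) powr (q / 2)"
      using C(2)[where n=n and a=a] assms by (intro powr_mono2) auto
    moreover have "((lq_norm 2 n a)\<^sup>2) powr (q / 2) = lq_norm 2 n a powr q"
      using powr_powr[of "lq_norm 2 n a" 2 "q / 2"] by simp
    moreover have "(C * ?M powr (2 / q)) powr (q / 2) = C powr (q / 2) * ?M"
      using C assms by (simp add: powr_mult powr_powr mean_nonneg)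
    ultimately show "lq_norm 2 n a powr q \<le> C powr (q / 2) * ?M" by simp
  qed
qed

section \<open>Linear maps into finite dimensional sequence spaces\<close>

lemma mean_sum: "mean A (\<lambda>x. \<Sum>t\<in>I. f t x) = (\<Sum>t\<in>I. mean A (f t))"
  unfolding mean_def by (subst sum.swap) (simp add: sum_divide_distrib)

text \<open>
  The constant \<open>W\<close> bounds the weak \<open>P\<close>-norm of the vectors \<open>c j\<close> of \<open>\<ell>\<^sub>2\<^sup>n\<close>, and \<open>u\<close> is the matrix of a
  linear map into \<open>\<ell>\<^sub>q\<^sup>N\<close>. Since \<open>P \<ge> q\<close>, Minkowski's inequality moves the sum over \<open>j\<close> inside the sum over
  the coordinates \<open>t\<close> of \<open>\<ell>\<^sub>q\<^sup>N\<close>. In each coordinate \<open>u\<close> is a functional, which the weak norm bounds by its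
  \<open>\<ell>\<^sub>2\<close>-norm, and Khinchine's inequality replaces that norm by a moment over signs.
\<close>

lemma lq_summing_bound:
  fixes q P :: real
  assumes q: "0 < q" "q \<le> P"
  shows "\<exists>C>0. \<forall>n N (J :: nat) W (u :: nat \<Rightarrow> nat \<Rightarrow> 'k::real_or_complex) c.
      0 \<le> W \<longrightarrow> (\<forall>a. (\<Sum>j<J. norm (\<Sum>i<n. c j i * a i) powr P) \<le> (W * lq_norm 2 n a) powr P) \<longrightarrow>
      (\<Sum>j<J. lq_norm q N (\<lambda>t. \<Sum>i<n. c j i * u t i) powr P)
        \<le> C * W powr P * mean {..<2 ^ n} (\<lambda>j. lq_norm q N (\<lambda>t. \<Sum>i<n. rad j i *\<^sub>R u t i) powr q) powr (P / q)"
proof -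
  obtain A where A: "A > 0"
    "\<And>n (a :: nat \<Rightarrow> 'k). lq_norm 2 n a powr q \<le> A * mean {..<2 ^ n} (\<lambda>j. norm (\<Sum>i<n. rad j i *\<^sub>R a i) powr q)"
    by (rule khinchine_lower[OF q(1)]) (rule that)
  show ?thesis
  proof (intro exI[of _ "A powr (P / q)"] conjI allI impI)
    show "A powr (P / q) > 0" using A by simp
    fix n N J :: nat and W and u c :: "nat \<Rightarrow> nat \<Rightarrow> 'k"
    assume W: "0 \<le> W"
      and c: "\<forall>a. (\<Sum>j<J. norm (\<Sum>i<n. c j i * a i) powr P) \<le> (W * lq_norm 2 n a) powr P"
    let ?v = "\<lambda>j t. \<Sum>i<n. c j i * u t i"
    let ?M = "mean {..<2 ^ n} (\<lambda>j. lq_norm q N (\<lambda>t. \<Sum>i<n. rad j i *\<^sub>R u t i) powr q)"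
    have "(\<Sum>j<J. lq_norm q N (?v j) powr P) = (\<Sum>j<J. (\<Sum>t<N. norm (?v j t) powr q) powr (P / q))"
      using q by (simp add: lq_norm_def powr_powr)
    also have "\<dots> \<le> (\<Sum>t<N. (\<Sum>j<J. (norm (?v j t) powr q) powr (P / q)) powr (1 / (P / q))) powr (P / q)"
      using q by (intro minkowski_powr) auto
    also have "\<dots> = (\<Sum>t<N. (\<Sum>j<J. norm (?v j t) powr P) powr (q / P)) powr (P / q)"
      using q by (simp add: powr_powr)
    also have "\<dots> \<le> (\<Sum>t<N. W powr q * (A * mean {..<2 ^ n} (\<lambda>j. norm (\<Sum>i<n. rad j i *\<^sub>R u t i) powr q))) powr (P / q)"
    proof (intro powr_mono2 sum_mono)
      fix t
      have "(\<Sum>j<J. norm (?v j t) powr P) powr (q / P) \<le> ((W * lq_norm 2 n (u t)) powr P) powr (q / P)"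
        using q c by (intro powr_mono2) (auto intro: sum_nonneg)
      also have "\<dots> = W powr q * lq_norm 2 n (u t) powr q"
        using q W by (simp add: powr_powr powr_mult)
      also have "\<dots> \<le> W powr q * (A * mean {..<2 ^ n} (\<lambda>j. norm (\<Sum>i<n. rad j i *\<^sub>R u t i) powr q))"
        using A(2) by (intro mult_left_mono) auto
      finally show "(\<Sum>j<J. norm (?v j t) powr P) powr (q / P) \<le> \<dots>" .
    qed (use q in \<open>auto intro: sum_nonneg\<close>)
    also have "(\<Sum>t<N. W powr q * (A * mean {..<2 ^ n} (\<lambda>j. norm (\<Sum>i<n. rad j i *\<^sub>R u t i) powr q))) = W powr q * A * ?M"
      by (simp add: lq_norm_powr[OF q(1)] mean_sum sum_distrib_left mult.assoc)
    also have "(W powr q * A * ?M) powr (P / q) = A powr (P / q) * W powr P * ?M powr (P / q)"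
      using A q by (simp add: powr_mult powr_powr mean_nonneg)
    finally show "(\<Sum>j<J. lq_norm q N (?v j) powr P) \<le> A powr (P / q) * W powr P * ?M powr (P / q)" .
  qed
qed

text \<open>
  Kahane's inequality for sign sums in \<open>\<ell>\<^sub>q\<^sup>N\<close>. The summing bound applied to the sign vectors themselves,
  which are weakly summable by Khinchine's inequality, compares the moments of order \<open>2 P\<close> and \<open>P\<close>; this
  comparison propagates to smaller exponents.
\<close>

lemma lq_kahane:
  fixes q P s :: real
  assumes q: "0 < q" "q \<le> P" and s: "0 < s" "s < P"
  obtains C where "C > 0"
    "\<And>n N (u :: nat \<Rightarrow> nat \<Rightarrow> 'k::real_or_complex).
      mean {..<2 ^ n} (\<lambda>j. lq_norm q N (\<lambda>t. \<Sum>i<n. rad j i *\<^sub>R u t i) powr P)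
        \<le> C * mean {..<2 ^ n} (\<lambda>j. lq_norm q N (\<lambda>t. \<Sum>i<n. rad j i *\<^sub>R u t i) powr s) powr (P / s)"
proof -
  have P: "0 < P" "q \<le> 2 * P" using q by auto
  obtain B where B: "B > 0"
    "\<And>n (a :: nat \<Rightarrow> 'k). mean {..<2 ^ n} (\<lambda>j. norm (\<Sum>i<n. rad j i *\<^sub>R a i) powr (2 * P)) \<le> B * lq_norm 2 n a powr (2 * P)"
    using khinchine_upper[of "2 * P"] P by auto
  obtain C1 where C1: "C1 > 0"
    "\<forall>n N (J :: nat) W (u :: nat \<Rightarrow> nat \<Rightarrow> 'k) c.
      0 \<le> W \<longrightarrow> (\<forall>a. (\<Sum>j<J. norm (\<Sum>i<n. c j i * a i) powr (2 * P)) \<le> (W * lq_norm 2 n a) powr (2 * P)) \<longrightarrow>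
      (\<Sum>j<J. lq_norm q N (\<lambda>t. \<Sum>i<n. c j i * u t i) powr (2 * P))
        \<le> C1 * W powr (2 * P) * mean {..<2 ^ n} (\<lambda>j. lq_norm q N (\<lambda>t. \<Sum>i<n. rad j i *\<^sub>R u t i) powr q) powr (2 * P / q)"
    using lq_summing_bound[OF q(1) P(2), where 'k = 'k] by blast
  obtain C where C: "C > 0" "\<And>A f. \<lbrakk>\<And>x :: nat. x \<in> A \<Longrightarrow> 0 \<le> f x;
        mean A (\<lambda>x. f x powr (2 * P)) \<le> C1 * B * mean A (\<lambda>x. f x powr P) powr (2 * P / P)\<rbrakk>
       \<Longrightarrow> mean A (\<lambda>x. f x powr P) \<le> C * mean A (\<lambda>x. f x powr s) powr (P / s)"
    using reverse_power_mean[of s P "2 * P" "C1 * B"] s B(1) C1(1) P by auto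
  show thesis
  proof (rule that[OF C(1)], rule C(2))
    fix n N :: nat and u :: "nat \<Rightarrow> nat \<Rightarrow> 'k"
    let ?f = "\<lambda>j. lq_norm q N (\<lambda>t. \<Sum>i<n. rad j i *\<^sub>R u t i)"
    \<comment> \<open>the weak norm of the family of all sign vectors\<close>
    define W where "W = (2 ^ n * B) powr (1 / (2 * P))"
    have W: "W powr (2 * P) = 2 ^ n * B" using B P by (simp add: W_def powr_powr)
    have "(\<Sum>j<2 ^ n. ?f j powr (2 * P)) = (\<Sum>j<2 ^ n. lq_norm q N (\<lambda>t. \<Sum>i<n. of_real (rad j i) * u t i) powr (2 * P))"
      by (simp add: scaleR_conv_of_real)
    also have "\<dots> \<le> C1 * W powr (2 * P) * mean {..<2 ^ n} (\<lambda>j. ?f j powr q) powr (2 * P / q)"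
    proof (rule C1(2)[rule_format])
      show "0 \<le> W" by (simp add: W_def)
      fix a :: "nat \<Rightarrow> 'k"
      have "(\<Sum>j<2 ^ n. norm (\<Sum>i<n. of_real (rad j i) * a i) powr (2 * P)) = 2 ^ n * mean {..<2 ^ n} (\<lambda>j. norm (\<Sum>i<n. rad j i *\<^sub>R a i) powr (2 * P))"
        by (simp add: scaleR_conv_of_real mean_def)
      also have "\<dots> \<le> 2 ^ n * (B * lq_norm 2 n a powr (2 * P))"
        using B(2) by (intro mult_left_mono) auto
      also have "\<dots> = (W * lq_norm 2 n a) powr (2 * P)"
        using \<open>0 \<le> W\<close> by (simp add: powr_mult W)
      finally show "(\<Sum>j<2 ^ n. norm (\<Sum>i<n. of_real (rad j i) * a i) powr (2 * P)) \<le> \<dots>" .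
    qed
    also have "\<dots> = 2 ^ n * (C1 * B * mean {..<2 ^ n} (\<lambda>j. ?f j powr q) powr (2 * P / q))" by (simp add: W)
    finally have "mean {..<2 ^ n} (\<lambda>j. ?f j powr (2 * P)) \<le> C1 * B * mean {..<2 ^ n} (\<lambda>j. ?f j powr q) powr (2 * P / q)"
      by (simp add: mean_def divide_le_eq mult.commute)
    also have "\<dots> \<le> C1 * B * (mean {..<2 ^ n} (\<lambda>j. ?f j powr P) powr (q / P)) powr (2 * P / q)"
      using q P B(1) C1(1) by (intro mult_left_mono powr_mono2 power_mean_le mean_nonneg) (auto simp: lessThan_empty_iff)
    also have "\<dots> = C1 * B * mean {..<2 ^ n} (\<lambda>j. ?f j powr P) powr (2 * P / P)"
      using q P by (simp add: powr_powr)
    finally show "mean {..<2 ^ n} (\<lambda>j. ?f j powr (2 * P)) \<le> \<dots>" .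
  qed simp
qed


section \<open>From one variable to several\<close>

definition multi_indices :: "('m \<Rightarrow> nat) \<Rightarrow> ('m \<Rightarrow> nat) set" where
  "multi_indices J = {j. \<forall>k. j k < J k}"

lemma finite_multi_index_set [simp]: "finite (multi_indices (J :: 'm::finite \<Rightarrow> nat))"
  unfolding multi_indices_def by (rule finite_multi_indices)

lemma sum_multi_indices_split:
  fixes J :: "'m::finite \<Rightarrow> nat"
  shows "(\<Sum>j\<in>multi_indices J. f j) = (\<Sum>j\<in>multi_indices (J(k := 1)). \<Sum>i<J k. f (j(k := i)))"
proof -
  have "multi_indices (J(k := 1)) = {j. j k = 0 \<and> (\<forall>l. l \<noteq> k \<longrightarrow> j l < J l)}"
    unfolding multi_indices_def fun_upd_apply by (rule Collect_cong) (metis less_one)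
  then show ?thesis
    unfolding sum.cartesian_product
    by (intro sum.reindex_bij_witness[of _ "\<lambda>(j, i). j(k := i)" "\<lambda>j. (j(k := 0), j k)"])
      (auto simp: multi_indices_def fun_eq_iff)
qed

text \<open>
  If in each variable separately the sum over the given vectors is controlled by the sum over reference
  vectors, the same holds jointly: the variables in a set \<open>A\<close> have been replaced already, and \<open>A\<close> grows by one
  variable at a time.
\<close>

lemma sum_replace_coordinates:
  fixes F :: "('m::finite \<Rightarrow> 'e) \<Rightarrow> real"
  assumes step: "\<And>k z. (\<And>l. l \<noteq> k \<Longrightarrow> z l \<in> D) \<Longrightarrow>
      (\<Sum>i<J k. F (z(k := x k i))) \<le> C k * (\<Sum>i<J'. F (z(k := e i)))"
    and x: "\<And>k i. i < J k \<Longrightarrow> x k i \<in> D" and e: "\<And>i. i < J' \<Longrightarrow> e i \<in> D"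
    and C: "\<And>k. 0 \<le> C k"
  shows "(\<Sum>j\<in>multi_indices J. F (\<lambda>k. x k (j k)))
    \<le> (\<Prod>k\<in>UNIV. C k) * (\<Sum>j\<in>multi_indices (\<lambda>_. J'). F (\<lambda>k. e (j k)))"
proof -
  define JJ where "JJ A = (\<lambda>k. if k \<in> A then J' else J k)" for A
  define xx where "xx A j = (\<lambda>k. if k \<in> A then e (j k) else x k (j k))" for A and j :: "'m \<Rightarrow> nat"
  have "(\<Sum>j\<in>multi_indices J. F (\<lambda>k. x k (j k))) \<le> (\<Prod>k\<in>A. C k) * (\<Sum>j\<in>multi_indices (JJ A). F (xx A j))"
    for A :: "'m set"
  proof (induction A rule: finite_induct[OF finite])
    case 1
    then show ?case by (simp add: JJ_def xx_def)
  next
    case (2 k A)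
    have rest: "(JJ (insert k A))(k := 1) = (JJ A)(k := 1)" by (auto simp: JJ_def)
    have "(\<Sum>j\<in>multi_indices (JJ A). F (xx A j))
        = (\<Sum>j\<in>multi_indices ((JJ A)(k := 1)). \<Sum>i<JJ A k. F (xx A (j(k := i))))"
      by (rule sum_multi_indices_split)
    also have "\<dots> = (\<Sum>j\<in>multi_indices ((JJ A)(k := 1)). \<Sum>i<J k. F ((xx A j)(k := x k i)))"
      using 2 by (intro sum.cong arg_cong[where f = F]) (auto simp: xx_def JJ_def)
    also have "\<dots> \<le> (\<Sum>j\<in>multi_indices ((JJ A)(k := 1)). C k * (\<Sum>i<J'. F ((xx A j)(k := e i))))"
    proof (intro sum_mono step)
      fix j l assume j: "j \<in> multi_indices ((JJ A)(k := 1))" and l: "l \<noteq> k"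
      then have "j l < JJ A l" by (auto simp: multi_indices_def dest: spec[of _ l])
      then show "xx A j l \<in> D" using x e by (auto simp: xx_def JJ_def split: if_splits)
    qed
    also have "\<dots> = C k * (\<Sum>j\<in>multi_indices ((JJ (insert k A))(k := 1)). \<Sum>i<JJ (insert k A) k. F (xx (insert k A) (j(k := i))))"
      unfolding rest sum_distrib_left[symmetric]
      by (intro arg_cong[where f = "\<lambda>t. C k * t"] sum.cong arg_cong[where f = F]) (auto simp: xx_def JJ_def)
    also have "\<dots> = C k * (\<Sum>j\<in>multi_indices (JJ (insert k A)). F (xx (insert k A) j))"
      by (simp only: sum_multi_indices_split[of _ "JJ (insert k A)" k])
    finally have "(\<Prod>k\<in>A. C k) * (\<Sum>j\<in>multi_indices (JJ A). F (xx A j)) \<le> (\<Prod>k\<in>A. C k) * \<dots>"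
      using C by (intro mult_left_mono prod_nonneg) auto
    then show ?case using 2 by (simp add: mult_ac)
  qed
  from this[of UNIV] show ?thesis by (simp add: JJ_def xx_def)
qed

text \<open>
  A comparison of powers that holds in each variable separately holds jointly. When the variable \<open>k\<close> is
  added to the set \<open>A\<close>, Minkowski's inequality exchanges the outer power sum over the variables in \<open>A\<close> with
  the inner sum over \<open>k\<close>, after which the bound for \<open>A\<close> applies to each inner term.
\<close>

lemma sum_powr_tensorize:
  fixes F :: "('m::finite \<Rightarrow> 'e) \<Rightarrow> real"
  assumes step: "\<And>k z. (\<And>l. l \<noteq> k \<Longrightarrow> z l \<in> D) \<Longrightarrow>
      (\<Sum>i<J. F (z(k := e i)) powr r) \<le> C * (\<Sum>i<J. F (z(k := e i))) powr r"
    and e: "\<And>i. i < J \<Longrightarrow> e i \<in> D"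
    and C: "0 \<le> C" and r: "1 \<le> r" and F: "\<And>z. 0 \<le> F z"
  shows "(\<Sum>j\<in>multi_indices (\<lambda>_. J). F (\<lambda>k. e (j k)) powr r)
    \<le> C ^ CARD('m) * (\<Sum>j\<in>multi_indices (\<lambda>_. J). F (\<lambda>k. e (j k))) powr r"
proof -
  define JJ where "JJ A = (\<lambda>k. if k \<in> A then J else 1)" for A :: "'m set"
  define xx where "xx A z j = (\<lambda>k. if k \<in> A then e (j k) else z k)" for A and z :: "'m \<Rightarrow> 'e" and j :: "'m \<Rightarrow> nat"
  have "(\<Sum>j\<in>multi_indices (JJ A). F (xx A z j) powr r) \<le> C ^ card A * (\<Sum>j\<in>multi_indices (JJ A). F (xx A z j)) powr r"
    if "\<And>l. l \<notin> A \<Longrightarrow> z l \<in> D" for A z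
    using that
  proof (induction A arbitrary: z rule: finite_induct[OF finite])
    case 1
    have "multi_indices (JJ {}) = {\<lambda>_. 0}" by (auto simp: multi_indices_def JJ_def)
    then show ?case by simp
  next
    case (2 k A)
    have rest: "(JJ (insert k A))(k := 1) = JJ A" using 2 by (auto simp: JJ_def)
    have split: "(\<Sum>j\<in>multi_indices (JJ (insert k A)). g (xx (insert k A) z j))
        = (\<Sum>j\<in>multi_indices (JJ A). \<Sum>i<J. g ((xx A z j)(k := e i)))" for g :: "('m \<Rightarrow> 'e) \<Rightarrow> real"
    proof -
      have "(\<Sum>j\<in>multi_indices (JJ (insert k A)). g (xx (insert k A) z j))
        = (\<Sum>j\<in>multi_indices (JJ A). \<Sum>i<JJ (insert k A) k. g (xx (insert k A) z (j(k := i))))"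
        unfolding rest[symmetric] by (rule sum_multi_indices_split)
      also have "\<dots> = (\<Sum>j\<in>multi_indices (JJ A). \<Sum>i<J. g ((xx A z j)(k := e i)))"
        by (intro sum.cong arg_cong[where f = g]) (auto simp: xx_def JJ_def)
      finally show ?thesis .
    qed
    have upd: "(xx A z j)(k := e i) = xx A (z(k := e i)) j" for i j
      using 2 by (auto simp: xx_def)
    have "(\<Sum>j\<in>multi_indices (JJ (insert k A)). F (xx (insert k A) z j) powr r)
        = (\<Sum>j\<in>multi_indices (JJ A). \<Sum>i<J. F ((xx A z j)(k := e i)) powr r)"
      by (rule split)
    also have "\<dots> \<le> (\<Sum>j\<in>multi_indices (JJ A). C * (\<Sum>i<J. F ((xx A z j)(k := e i))) powr r)"
    proof (intro sum_mono step)
      fix j l assume j: "j \<in> multi_indices (JJ A)" and l: "l \<noteq> k"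
      then have "j l < JJ A l" by (auto simp: multi_indices_def)
      then show "xx A z j l \<in> D" using 2(4) e l by (auto simp: xx_def JJ_def split: if_splits)
    qed
    also have "\<dots> = C * (\<Sum>j\<in>multi_indices (JJ A). (\<Sum>i<J. F ((xx A z j)(k := e i))) powr r)"
      by (simp add: sum_distrib_left)
    also have "\<dots> \<le> C * (\<Sum>i<J. (\<Sum>j\<in>multi_indices (JJ A). F ((xx A z j)(k := e i)) powr r) powr (1 / r)) powr r"
      using C r F by (intro mult_left_mono minkowski_powr) auto
    also have "\<dots> \<le> C * (\<Sum>i<J. (C ^ card A * (\<Sum>j\<in>multi_indices (JJ A). F ((xx A z j)(k := e i))) powr r) powr (1 / r)) powr r"
      unfolding upd
    proof (intro mult_left_mono powr_mono2 sum_mono "2.IH")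
      fix i l assume "i \<in> {..<J}" "l \<notin> A"
      then show "(z(k := e i)) l \<in> D" using 2(4) e by auto
    qed (use C r in \<open>auto intro!: sum_nonneg\<close>)
    also have "\<dots> = C * ((C ^ card A) powr (1 / r) * (\<Sum>i<J. \<Sum>j\<in>multi_indices (JJ A). F ((xx A z j)(k := e i)))) powr r"
    proof -
      have "(C ^ card A * S powr r) powr (1 / r) = (C ^ card A) powr (1 / r) * S" if "0 \<le> S" for S
        using that C r by (simp add: powr_mult powr_powr)
      then show ?thesis using F by (simp add: sum_nonneg sum_distrib_left)
    qed
    also have "\<dots> = C * C ^ card A * (\<Sum>i<J. \<Sum>j\<in>multi_indices (JJ A). F ((xx A z j)(k := e i))) powr r"
      using C r F by (simp add: powr_mult powr_powr sum_nonneg)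
    also have "(\<Sum>i<J. \<Sum>j\<in>multi_indices (JJ A). F ((xx A z j)(k := e i))) = (\<Sum>j\<in>multi_indices (JJ (insert k A)). F (xx (insert k A) z j))"
      unfolding split by (rule sum.swap)
    finally show ?case using 2 by (simp add: mult_ac)
  qed
  from this[of UNIV undefined] show ?thesis by (simp add: JJ_def xx_def)
qed

lemma card_multi_indices: "card (multi_indices (\<lambda>_ :: 'm::finite. J)) = J ^ CARD('m)"
proof -
  have "multi_indices (\<lambda>_ :: 'm. J) = PiE UNIV (\<lambda>_. {..<J})"
    by (auto simp: multi_indices_def PiE_def)
  then show ?thesis by (simp add: card_PiE)
qed

text \<open>
  The hypothesis on \<open>F\<close> holds for the norm of a multilinear map with values in \<open>\<ell>\<^sub>q\<^sup>N\<close>, evaluated at the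
  sign sums \<open>e i\<close>. The constant depends neither on \<open>n\<close> nor on \<open>N\<close>: each variable contributes the factor
  \<open>C \<nu>\<^bsup>1 - P/s\<^esup>\<close> with \<open>\<nu> = 2\<^sup>n\<close>, and the powers of \<open>\<nu>\<close> are absorbed by the means.
\<close>

lemma multilinear_kahane:
  fixes q P s :: real
  assumes q: "0 < q" "q \<le> P" and s: "0 < s"
  shows "\<exists>K>0. \<forall>n (e :: nat \<Rightarrow> 'e) D (F :: ('m::finite \<Rightarrow> 'e) \<Rightarrow> real).
    (\<forall>i<2 ^ n. e i \<in> D) \<longrightarrow> (\<forall>z. 0 \<le> F z) \<longrightarrow>
    (\<forall>k z. (\<forall>l. l \<noteq> k \<longrightarrow> z l \<in> D) \<longrightarrow>
       (\<exists>N (u :: nat \<Rightarrow> nat \<Rightarrow> 'k::real_or_complex). \<forall>i<2 ^ n. F (z(k := e i)) = lq_norm q N (\<lambda>t. \<Sum>l<n. rad i l *\<^sub>R u t l))) \<longrightarrow>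
    mean (multi_indices (\<lambda>_. 2 ^ n)) (\<lambda>j. F (\<lambda>k. e (j k)) powr P)
      \<le> K * mean (multi_indices (\<lambda>_. 2 ^ n)) (\<lambda>j. F (\<lambda>k. e (j k)) powr s) powr (P / s)"
proof (cases "P \<le> s")
  case True
  have "multi_indices (\<lambda>_ :: 'm. 2 ^ n) \<noteq> {}" for n
    using card_multi_indices[of "2 ^ n", where 'm = 'm] by (metis card.empty power_not_zero zero_neq_numeral)
  then show ?thesis using q True by (intro exI[of _ 1]) (simp add: power_mean_le)
next
  case False
  then have sP: "s < P" by simp
  obtain C where C: "C > 0"
    "\<And>n N (u :: nat \<Rightarrow> nat \<Rightarrow> 'k).
      mean {..<2 ^ n} (\<lambda>j. lq_norm q N (\<lambda>t. \<Sum>i<n. rad j i *\<^sub>R u t i) powr P)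
        \<le> C * mean {..<2 ^ n} (\<lambda>j. lq_norm q N (\<lambda>t. \<Sum>i<n. rad j i *\<^sub>R u t i) powr s) powr (P / s)"
    by (rule lq_kahane[OF q s sP]) (rule that)
  show ?thesis
  proof (intro exI[of _ "C ^ CARD('m)"] conjI allI impI)
    show "C ^ CARD('m) > 0" using C by simp
    fix n and e :: "nat \<Rightarrow> 'e" and D and F :: "('m \<Rightarrow> 'e) \<Rightarrow> real"
    assume e: "\<forall>i<2 ^ n. e i \<in> D" and F: "\<forall>z. 0 \<le> F z"
      and rep: "\<forall>k z. (\<forall>l. l \<noteq> k \<longrightarrow> z l \<in> D) \<longrightarrow>
       (\<exists>N (u :: nat \<Rightarrow> nat \<Rightarrow> 'k). \<forall>i<2 ^ n. F (z(k := e i)) = lq_norm q N (\<lambda>t. \<Sum>l<n. rad i l *\<^sub>R u t l))"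
    define \<nu> :: real where "\<nu> = 2 ^ n"
    have \<nu>: "\<nu> > 0" by (simp add: \<nu>_def)
    \<comment> \<open>written with sums instead of means, the comparison in one variable has this constant\<close>
    define C' where "C' = C * \<nu> powr (1 - P / s)"
    let ?I = "multi_indices (\<lambda>_ :: 'm. 2 ^ n)"
    let ?S = "\<Sum>j\<in>?I. F (\<lambda>k. e (j k)) powr s"
    have "(\<Sum>j\<in>?I. (F (\<lambda>k. e (j k)) powr s) powr (P / s)) \<le> C' ^ CARD('m) * ?S powr (P / s)"
    proof (rule sum_powr_tensorize)
      fix k and z :: "'m \<Rightarrow> 'e" assume "\<And>l. l \<noteq> k \<Longrightarrow> z l \<in> D"
      then obtain N and u :: "nat \<Rightarrow> nat \<Rightarrow> 'k" where
        Fz: "\<And>i. i < 2 ^ n \<Longrightarrow> F (z(k := e i)) = lq_norm q N (\<lambda>t. \<Sum>l<n. rad i l *\<^sub>R u t l)"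
        using rep by metis
      have meanF: "mean {..<2 ^ n} (\<lambda>i. F (z(k := e i)) powr r) = mean {..<2 ^ n} (\<lambda>j. lq_norm q N (\<lambda>t. \<Sum>i<n. rad j i *\<^sub>R u t i) powr r)" for r
        unfolding mean_def using Fz by simp
      have "(\<Sum>i<2 ^ n. F (z(k := e i)) powr P) / \<nu> \<le> C * ((\<Sum>i<2 ^ n. F (z(k := e i)) powr s) / \<nu>) powr (P / s)"
        using C(2)[of n N u] unfolding meanF[symmetric] by (simp add: mean_def \<nu>_def)
      then have "(\<Sum>i<2 ^ n. F (z(k := e i)) powr P) \<le> C * \<nu> powr (1 - P / s) * (\<Sum>i<2 ^ n. F (z(k := e i)) powr s) powr (P / s)"
        using \<nu> by (simp add: powr_divide powr_diff sum_nonneg field_simps)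
      then show "(\<Sum>i<2 ^ n. (F (z(k := e i)) powr s) powr (P / s)) \<le> C' * (\<Sum>i<2 ^ n. F (z(k := e i)) powr s) powr (P / s)"
        using s by (simp add: powr_powr C'_def)
    qed (use e C \<nu> sP s in \<open>auto simp: C'_def\<close>)
    then have "(\<Sum>j\<in>?I. F (\<lambda>k. e (j k)) powr P) \<le> C' ^ CARD('m) * ?S powr (P / s)"
      using s by (simp add: powr_powr)
    also have "C' ^ CARD('m) = C ^ CARD('m) * (\<nu> ^ CARD('m) / (\<nu> ^ CARD('m)) powr (P / s))"
    proof -
      have "(\<nu> powr (1 - P / s)) ^ CARD('m) = \<nu> ^ CARD('m) / (\<nu> ^ CARD('m)) powr (P / s)"
        using \<nu> by (simp add: powr_diff power_divide powr_power powr_powr flip: powr_realpow) (simp add: mult.commute)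
      then show ?thesis by (simp add: C'_def power_mult_distrib)
    qed
    also have "C ^ CARD('m) * (\<nu> ^ CARD('m) / (\<nu> ^ CARD('m)) powr (P / s)) * ?S powr (P / s)
        = \<nu> ^ CARD('m) * (C ^ CARD('m) * (?S / \<nu> ^ CARD('m)) powr (P / s))"
      using \<nu> by (simp add: powr_divide sum_nonneg)
    finally have "(\<Sum>j\<in>?I. F (\<lambda>k. e (j k)) powr P) / \<nu> ^ CARD('m) \<le> C ^ CARD('m) * (?S / \<nu> ^ CARD('m)) powr (P / s)"
      using \<nu> by (simp add: divide_le_eq mult.commute)
    then show "mean ?I (\<lambda>j. F (\<lambda>k. e (j k)) powr P) \<le> C ^ CARD('m) * mean ?I (\<lambda>j. F (\<lambda>k. e (j k)) powr s) powr (P / s)"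
      by (simp add: mean_def card_multi_indices \<nu>_def)
  qed
qed


section \<open>Finite dimensional subspaces\<close>

lemma Cauchy_convergent_if_isometric:
  fixes c :: "nat \<Rightarrow> 'k::real_normed_field" and \<phi> :: "'k \<Rightarrow> 'b::{real_normed_field,banach}"
  assumes "Cauchy c" and iso: "isometric_field_iso \<phi>"
  shows "convergent c"
proof -
  have bij: "bij \<phi>" and nrm: "norm (\<phi> x) = norm x" and add: "\<phi> (x + y) = \<phi> x + \<phi> y" for x y
    using iso by (auto simp: isometric_field_iso_def)
  have diff: "\<phi> (x - y) = \<phi> x - \<phi> y" for x y
    using add[of "x - y" y] by simp
  have dist: "dist (\<phi> x) (\<phi> y) = dist x y" for x y
    by (simp add: dist_norm nrm flip: diff)
  have "Cauchy (\<lambda>n. \<phi> (c n))" using assms(1) by (simp add: Cauchy_def dist)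
  then obtain L where L: "(\<lambda>n. \<phi> (c n)) \<longlonglongrightarrow> L" using Cauchy_convergent convergent_def by blast
  have "L = \<phi> (inv \<phi> L)" using bij by (simp add: bij_is_surj surj_f_inv_f)
  then have "(\<lambda>n. dist (\<phi> (c n)) (\<phi> (inv \<phi> L))) \<longlonglongrightarrow> 0" using L by (metis tendsto_dist_iff)
  then have "c \<longlonglongrightarrow> inv \<phi> L" by (simp only: dist tendsto_dist_iff[of c])
  then show ?thesis by (auto simp: convergent_def)
qed

text \<open>
  The class of scalar fields contains completeness only through the isometry with the reals or the
  complex numbers.
\<close>

lemma scalar_Cauchy_convergent:
  fixes c :: "nat \<Rightarrow> 'k::real_or_complex"
  assumes "Cauchy c"
  shows "convergent c"
  using real_or_complex[where 'a = 'k]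
proof
  assume "\<exists>\<phi> :: 'k \<Rightarrow> real. isometric_field_iso \<phi>"
  then obtain \<phi> :: "'k \<Rightarrow> real" where "isometric_field_iso \<phi>" by (rule exE)
  then show ?thesis by (rule Cauchy_convergent_if_isometric[OF assms])
next
  assume "\<exists>\<phi> :: 'k \<Rightarrow> complex. isometric_field_iso \<phi>"
  then obtain \<phi> :: "'k \<Rightarrow> complex" where "isometric_field_iso \<phi>" by (rule exE)
  then show ?thesis by (rule Cauchy_convergent_if_isometric[OF assms])
qed

context normed_space_over
begin

text \<open>
  The distance from \<open>b\<close> to the closed subspace bounds the coefficient of \<open>b\<close>.
\<close>

lemma scale_dist_span:
  assumes "closed (span B)" "b \<notin> span B"
  obtains \<delta> where "\<delta> > 0" "\<And>v c. v \<in> span B \<Longrightarrow> norm c * \<delta> \<le> norm (v + scale c b)"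
proof -
  have "open (- span B)" "b \<in> - span B" using assms by auto
  then obtain \<delta> where d: "\<delta> > 0" "\<And>y. dist y b < \<delta> \<Longrightarrow> y \<in> - span B"
    unfolding open_dist by blast
  show thesis
  proof (rule that[OF d(1)])
    fix v c assume v: "v \<in> span B"
    show "norm c * \<delta> \<le> norm (v + scale c b)"
    proof (cases "c = 0")
      case False
      have "- scale (1 / c) v \<in> span B" using v by (intro span_neg span_scale)
      then have "\<delta> \<le> dist (- scale (1 / c) v) b" using d(2) by force
      also have "\<dots> = norm (scale (1 / c) v + b)"
        by (simp add: dist_norm) (metis add.commute minus_add_distrib norm_minus_cancel uminus_add_conv_diff diff_minus_eq_add minus_diff_eq add_uminus_conv_diff)
      finally have "norm c * \<delta> \<le> norm (scale c (scale (1 / c) v + b))"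
        unfolding norm_scale by (intro mult_left_mono) auto
      then show ?thesis using False by (simp add: scale_right_distrib)
    qed simp
  qed
qed

text \<open>
  When a sequence in the larger span converges, the coefficients of the new vector form a Cauchy sequence, so
  they converge and so do the remaining components, within the smaller span.
\<close>

lemma closed_span_finite:
  assumes "finite B"
  shows "closed (span B)"
  using assms
proof (induction B)
  case empty
  then show ?case by simp
next
  case (insert b B)
  show ?case
  proof (cases "b \<in> span B")
    case True
    then show ?thesis using insert by (simp add: span_redundant)
  next
    case False
    obtain \<delta> where d: "\<delta> > 0" "\<And>v c. v \<in> span B \<Longrightarrow> norm c * \<delta> \<le> norm (v + scale c b)"
      using scale_dist_span[OF insert.IH False] by blast
    show ?thesis
      unfolding closed_sequential_limits
    proof (intro allI impI, elim conjE)
      fix x l assume x: "\<forall>n. x n \<in> span (insert b B)" and l: "x \<longlonglongrightarrow> l"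
      obtain c where c: "\<And>n. x n - scale (c n) b \<in> span B"
        using x unfolding span_insert by simp metis
      have "Cauchy c"
      proof (rule metric_CauchyI)
        fix e :: real assume "e > 0"
        then obtain M where M: "\<forall>m\<ge>M. \<forall>n\<ge>M. dist (x m) (x n) < e * \<delta>"
          using metric_CauchyD[OF LIMSEQ_imp_Cauchy[OF l], of "e * \<delta>"] d(1) by auto
        have "dist (c m) (c n) < e" if "m \<ge> M" "n \<ge> M" for m n
        proof -
          have "(x m - scale (c m) b) - (x n - scale (c n) b) \<in> span B" by (rule span_diff[OF c c])
          from d(2)[OF this, of "c m - c n"] have "norm (c m - c n) * \<delta> \<le> norm (x m - x n)"
            by (simp add: scale_left_diff_distrib)
          also have "\<dots> < e * \<delta>" using M that by (simp add: dist_norm)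
          finally show ?thesis using d(1) by (simp add: dist_norm)
        qed
        then show "\<exists>M. \<forall>m\<ge>M. \<forall>n\<ge>M. dist (c m) (c n) < e" by blast
      qed
      then obtain c0 where c0: "c \<longlonglongrightarrow> c0" using scalar_Cauchy_convergent convergent_def by blast
      have "(\<lambda>n. scale (c n) b) \<longlonglongrightarrow> scale c0 b"
      proof -
        have "(\<lambda>n. norm (c n - c0) * norm b) \<longlonglongrightarrow> 0 * norm b"
          using c0 by (intro tendsto_intros) (simp add: LIM_zero tendsto_norm_zero)
        then have "(\<lambda>n. norm (scale (c n) b - scale c0 b)) \<longlonglongrightarrow> 0"
          by (simp add: norm_scale flip: scale_left_diff_distrib)
        then show ?thesis by (rule LIM_zero_cancel[OF tendsto_norm_zero_cancel])
      qed
      then have "(\<lambda>n. x n - scale (c n) b) \<longlonglongrightarrow> l - scale c0 b" using l by (intro tendsto_diff)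
      then have "l - scale c0 b \<in> span B" by (rule closed_sequentially[OF insert.IH c])
      then show "l \<in> span (insert b B)" unfolding span_insert by (intro CollectI exI)
    qed
  qed
qed

text \<open>
  Both the coefficient of a new basis vector and the remaining component are bounded by multiples of the norm.
\<close>

lemma functional_bounded_on_finite_span:
  assumes "finite B" and lin: "linear_on_subspace (span B) scale (*) f"
  obtains C where "0 \<le> C" "\<And>x. x \<in> span B \<Longrightarrow> norm (f x) \<le> C * norm x"
proof -
  have "\<exists>C\<ge>0. \<forall>x\<in>span B. norm (f x) \<le> C * norm x" using assms
  proof (induction B)
    case empty
    have "f (0 + 0) = f 0 + f 0" using empty by (auto simp: linear_on_subspace_def)
    then show ?case by auto
  next
    case (insert b B)
    have sub: "span B \<subseteq> span (insert b B)" by (intro span_mono) auto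
    then have "linear_on_subspace (span B) scale (*) f"
      using insert.prems unfolding linear_on_subspace_def by blast
    then obtain C where C: "C \<ge> 0" "\<And>x. x \<in> span B \<Longrightarrow> norm (f x) \<le> C * norm x"
      using insert.IH by blast
    show ?case
    proof (cases "b \<in> span B")
      case True
      then show ?thesis using C by (auto simp: span_redundant)
    next
      case False
      obtain \<delta> where d: "\<delta> > 0" "\<And>v c. v \<in> span B \<Longrightarrow> norm c * \<delta> \<le> norm (v + scale c b)"
        using scale_dist_span[OF closed_span_finite False] insert.hyps by blast
      define C' where "C' = C * (1 + norm b / \<delta>) + norm (f b) / \<delta>"
      have "norm (f x) \<le> C' * norm x" if x: "x \<in> span (insert b B)" for x
      proof -
        obtain c where c: "x - scale c b \<in> span B" using x unfolding span_insert by auto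
        have nc: "norm c \<le> norm x / \<delta>" using d(2)[OF c, of c] d(1) by (simp add: field_simps)
        have b: "b \<in> span (insert b B)" "scale c b \<in> span (insert b B)" by (auto intro: span_base span_scale)
        have "f x = f ((x - scale c b) + scale c b)" by simp
        also have "\<dots> = f (x - scale c b) + c * f b"
          using insert.prems b c sub unfolding linear_on_subspace_def by (metis subsetD)
        finally have "norm (f x) \<le> norm (f (x - scale c b)) + norm c * norm (f b)"
          by (metis norm_mult norm_triangle_ineq)
        also have "\<dots> \<le> C * (norm x + norm c * norm b) + norm c * norm (f b)"
          using C(2)[OF c] norm_triangle_ineq4[of x "scale c b"] C(1)
          by (intro add_right_mono order_trans[OF C(2)[OF c]] mult_left_mono) (auto simp: norm_scale)
        also have "\<dots> \<le> C * (norm x + norm x / \<delta> * norm b) + norm x / \<delta> * norm (f b)"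
          using nc C(1) by (intro add_mono mult_left_mono mult_right_mono) auto
        also have "\<dots> = C' * norm x" by (simp add: C'_def algebra_simps)
        finally show ?thesis .
      qed
      moreover have "C' \<ge> 0" using C d by (simp add: C'_def)
      ultimately show ?thesis by blast
    qed
  qed
  then show thesis using that by blast
qed

end


section \<open>The Hahn-Banach theorem\<close>

definition sublinear :: "('v::real_vector \<Rightarrow> real) \<Rightarrow> bool" where
  "sublinear p \<longleftrightarrow> (\<forall>x y. p (x + y) \<le> p x + p y) \<and> (\<forall>r x. 0 \<le> r \<longrightarrow> p (r *\<^sub>R x) \<le> r * p x)"

lemma sublinearD:
  assumes "sublinear p"
  shows "p (x + y) \<le> p x + p y" "0 \<le> r \<Longrightarrow> p (r *\<^sub>R x) = r * p x" "p 0 = 0" "- p (- x) \<le> p x"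
proof -
  have add: "p (x + y) \<le> p x + p y" and sc: "0 \<le> r \<Longrightarrow> p (r *\<^sub>R x) \<le> r * p x" for x y r
    using assms by (auto simp: sublinear_def)
  show "p (x + y) \<le> p x + p y" by (rule add)
  show p0: "p 0 = 0" using sc[of 0 0] add[of 0 0] by simp
  show "- p (- x) \<le> p x" using add[of x "- x"] p0 by simp
  show "p (r *\<^sub>R x) = r * p x" if "0 \<le> r"
  proof (cases "r = 0")
    case False
    then have r: "r > 0" using that by simp
    have "p (inverse r *\<^sub>R (r *\<^sub>R x)) \<le> inverse r * p (r *\<^sub>R x)" using r by (intro sc) auto
    then have "r * p x \<le> p (r *\<^sub>R x)" using r by (simp add: field_simps)
    then show ?thesis using sc[OF that] by (simp add: order_antisym)
  qed (simp add: p0)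
qed

text \<open>
  Zorn's lemma for the reversed pointwise order: the infimum of a chain is again sublinear, because any two
  members of the chain lie above the smaller one, and it is finite since \<open>- p (- x)\<close> is a lower bound.
\<close>

lemma minimal_sublinear_exists:
  fixes p :: "'v::real_vector \<Rightarrow> real"
  assumes p: "sublinear p"
  obtains g where "sublinear g" "g \<le> p" "\<And>h. sublinear h \<Longrightarrow> h \<le> g \<Longrightarrow> h = g"
proof -
  define A where "A = {g. sublinear g \<and> g \<le> p}"
  have "\<exists>m\<in>A. \<forall>a\<in>A. a \<le> m \<longrightarrow> a = m"
  proof (rule predicate_Zorn)
    show "partial_order_on A (relation_of (\<lambda>x y. y \<le> x) A)"
      by (auto simp: partial_order_on_def preorder_on_def relation_of_def
          refl_on_def trans_def antisym_def)
    fix C assume C: "C \<in> Chains (relation_of (\<lambda>x y. y \<le> x) A)"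
    then have CA: "C \<subseteq> A" and tot: "\<And>g h. g \<in> C \<Longrightarrow> h \<in> C \<Longrightarrow> g \<le> h \<or> h \<le> g"
      by (auto simp: Chains_def relation_of_def)
    show "\<exists>u\<in>A. \<forall>a\<in>C. u \<le> a"
    proof (cases "C = {}")
      case True
      then show ?thesis using p by (auto simp: A_def)
    next
      case False
      define u where "u x = (INF g\<in>C. g x)" for x
      have sub: "sublinear g" "g x \<le> p x" if "g \<in> C" for g x
        using that CA by (auto simp: A_def le_fun_def)
      have bdd: "bdd_below ((\<lambda>g. g x) ` C)" for x
      proof (rule bdd_belowI2)
        fix g assume g: "g \<in> C"
        show "- p (- x) \<le> g x" using sublinearD(4)[OF sub(1)[OF g], of x] sub(2)[OF g, of "- x"] by linarith
      qed
      have u_le: "u x \<le> g x" if "g \<in> C" for g x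
        unfolding u_def using bdd that by (rule cINF_lower)
      have le_u: "r \<le> u x" if "\<And>g. g \<in> C \<Longrightarrow> r \<le> g x" for r x
        unfolding u_def using False that by (rule cINF_greatest)
      have "sublinear u"
        unfolding sublinear_def
      proof (intro conjI allI impI)
        fix x y
        have "u (x + y) - g2 y \<le> u x" if g2: "g2 \<in> C" for g2
        proof (rule le_u)
          fix g1 assume g1: "g1 \<in> C"
          obtain g where "g \<in> C" "g \<le> g1" "g \<le> g2" using tot[OF g1 g2] g1 g2 by blast
          then have "u (x + y) \<le> g x + g y" using u_le[of g "x + y"] sublinearD(1)[OF sub(1), of g x y] by linarith
          moreover have "g x \<le> g1 x" "g y \<le> g2 y" using \<open>g \<le> g1\<close> \<open>g \<le> g2\<close> by (auto simp: le_fun_def)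
          ultimately show "u (x + y) - g2 y \<le> g1 x" by simp
        qed
        then have "u (x + y) - u x \<le> u y" by (intro le_u) (simp add: algebra_simps)
        then show "u (x + y) \<le> u x + u y" by simp
      next
        fix r :: real and x assume r: "0 \<le> r"
        show "u (r *\<^sub>R x) \<le> r * u x"
        proof (cases "r = 0")
          case True
          obtain g where "g \<in> C" using False by blast
          then show ?thesis using u_le[of g 0] sublinearD(3)[OF sub(1), of g] True by simp
        next
          case False
          then have r: "r > 0" using r by simp
          have "u (r *\<^sub>R x) / r \<le> u x"
          proof (rule le_u)
            fix g assume g: "g \<in> C"
            have "u (r *\<^sub>R x) \<le> r * g x" using u_le[OF g, of "r *\<^sub>R x"] sublinearD(2)[OF sub(1)[OF g], of r x] r by simp
            then show "u (r *\<^sub>R x) / r \<le> g x" using r by (simp add: field_simps)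
          qed
          then show ?thesis using r by (simp add: field_simps)
        qed
      qed
      moreover have "u \<le> p"
      proof -
        obtain g where "g \<in> C" using False by blast
        then show ?thesis using u_le sub(2) by (meson le_funI order_trans)
      qed
      ultimately show ?thesis using u_le by (intro bexI[of _ u]) (auto simp: A_def le_fun_def)
    qed
  qed
  then obtain g where g: "g \<in> A" "\<And>h. h \<in> A \<Longrightarrow> h \<le> g \<Longrightarrow> h = g" by blast
  show thesis
  proof (rule that)
    show "sublinear g" "g \<le> p" using g(1) by (auto simp: A_def)
    show "h = g" if "sublinear h" "h \<le> g" for h
      using that g by (auto simp: A_def)
  qed
qed

text \<open>
  A sublinear function that is odd is linear. For fixed \<open>y\<close> the function \<open>h\<close> below is the usual modification
  of \<open>g\<close> in the direction \<open>y\<close>; it is sublinear and below \<open>g\<close>, hence equal to \<open>g\<close>, and its value at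
  \<open>- y\<close> is at most \<open>- g y\<close>.
\<close>

lemma minimal_sublinear_linear:
  fixes g :: "'v::real_vector \<Rightarrow> real"
  assumes g: "sublinear g" and minimal: "\<And>h. sublinear h \<Longrightarrow> h \<le> g \<Longrightarrow> h = g"
  shows "linear g"
proof -
  note gD = sublinearD[OF g]
  have odd: "g (- y) = - g y" for y
  proof -
    define h where "h x = (INF t\<in>{0..}. g (x + t *\<^sub>R y) - t * g y)" for x
    have bdd: "bdd_below ((\<lambda>t. g (x + t *\<^sub>R y) - t * g y) ` {0..})" for x
    proof (rule bdd_belowI2)
      fix t :: real assume "t \<in> {0..}"
      then have "t * g y = g ((x + t *\<^sub>R y) + (- x))" using gD(2)[of t y] by simp
      also have "\<dots> \<le> g (x + t *\<^sub>R y) + g (- x)" by (rule gD)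
      finally show "- g (- x) \<le> g (x + t *\<^sub>R y) - t * g y" by simp
    qed
    have h_le: "h x \<le> g (x + t *\<^sub>R y) - t * g y" if "t \<ge> 0" for x t
      unfolding h_def using that by (intro cINF_lower bdd) auto
    have le_h: "r \<le> h x" if "\<And>t. t \<ge> 0 \<Longrightarrow> r \<le> g (x + t *\<^sub>R y) - t * g y" for r x
      unfolding h_def using that by (intro cINF_greatest) auto
    have "sublinear h"
      unfolding sublinear_def
    proof (intro conjI allI impI)
      fix x z
      have "h (x + z) - (g (z + s *\<^sub>R y) - s * g y) \<le> h x" if s: "s \<ge> 0" for s
      proof (rule le_h)
        fix t :: real assume t: "t \<ge> 0"
        have "h (x + z) \<le> g (x + z + (t + s) *\<^sub>R y) - (t + s) * g y" using s t by (intro h_le) auto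
        also have "x + z + (t + s) *\<^sub>R y = (x + t *\<^sub>R y) + (z + s *\<^sub>R y)" by (simp add: algebra_simps)
        also have "g \<dots> \<le> g (x + t *\<^sub>R y) + g (z + s *\<^sub>R y)" by (rule gD)
        finally show "h (x + z) - (g (z + s *\<^sub>R y) - s * g y) \<le> g (x + t *\<^sub>R y) - t * g y"
          by (simp add: algebra_simps)
      qed
      then have "h (x + z) - h x \<le> h z" by (intro le_h) (simp add: algebra_simps)
      then show "h (x + z) \<le> h x + h z" by simp
    next
      fix r :: real and x assume r: "0 \<le> r"
      show "h (r *\<^sub>R x) \<le> r * h x"
      proof (cases "r = 0")
        case True
        then show ?thesis using h_le[of 0 0] gD(3) by simp
      next
        case False
        then have r: "r > 0" using r by simp
        have "h (r *\<^sub>R x) / r \<le> h x"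
        proof (rule le_h)
          fix t :: real assume t: "t \<ge> 0"
          have "h (r *\<^sub>R x) \<le> g (r *\<^sub>R x + (r * t) *\<^sub>R y) - (r * t) * g y" using r t by (intro h_le) auto
          also have "r *\<^sub>R x + (r * t) *\<^sub>R y = r *\<^sub>R (x + t *\<^sub>R y)" by (simp add: algebra_simps)
          also have "g \<dots> = r * g (x + t *\<^sub>R y)" using r by (intro gD) auto
          finally show "h (r *\<^sub>R x) / r \<le> g (x + t *\<^sub>R y) - t * g y" using r by (simp add: field_simps)
        qed
        then show ?thesis using r by (simp add: field_simps)
      qed
    qed
    moreover have "h \<le> g" using h_le[of 0] by (auto simp: le_fun_def)
    ultimately have "h = g" by (rule minimal)
    then have "g (- y) \<le> - g y" using h_le[of 1 "- y"] gD(3) by simp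
    then show ?thesis using gD(4)[of y] by simp
  qed
  show ?thesis
  proof (rule linearI)
    fix x y
    have "g x \<le> g (x + y) + g (- y)" using gD(1)[of "x + y" "- y"] by simp
    then show "g (x + y) = g x + g y" using odd gD(1)[of x y] by simp
  next
    fix r x
    show "g (r *\<^sub>R x) = r *\<^sub>R g x"
    proof (cases "r \<ge> 0")
      case True
      then show ?thesis using gD(2) by simp
    next
      case False
      have "g (r *\<^sub>R x) = - g ((- r) *\<^sub>R x)" using odd[of "(- r) *\<^sub>R x"] by simp
      also have "\<dots> = r * g x" using gD(2)[of "- r" x] False by simp
      finally show ?thesis by simp
    qed
  qed
qed

text \<open>
  Any linear function below the infimal convolution \<open>p\<close> of \<open>f\<close> with the multiple of the norm solves the
  extension problem: \<open>p\<close> is at most \<open>f\<close> on \<open>M\<close>, where both functions are odd, and at most \<open>C * norm x\<close>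
  everywhere.
\<close>

lemma hahn_banach_real:
  fixes f :: "'v::real_normed_vector \<Rightarrow> real"
  assumes M: "subspace M"
    and add: "\<And>x y. x \<in> M \<Longrightarrow> y \<in> M \<Longrightarrow> f (x + y) = f x + f y"
    and scaleR: "\<And>r x. x \<in> M \<Longrightarrow> f (r *\<^sub>R x) = r * f x"
    and bound: "\<And>x. x \<in> M \<Longrightarrow> \<bar>f x\<bar> \<le> C * norm x" and C: "0 \<le> C"
  obtains g where "linear g" "\<And>x. x \<in> M \<Longrightarrow> g x = f x" "\<And>x. \<bar>g x\<bar> \<le> C * norm x"
proof -
  define p where "p x = (INF m\<in>M. f m + C * norm (x - m))" for x
  have M0: "0 \<in> M" using M by (rule subspace_0)
  have f0: "f 0 = 0" using scaleR[OF M0, of 0] by simp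
  have bdd: "bdd_below ((\<lambda>m. f m + C * norm (x - m)) ` M)" for x
  proof (rule bdd_belowI2)
    fix m assume m: "m \<in> M"
    have "C * norm m \<le> C * (norm x + norm (x - m))"
      using C norm_triangle_ineq4[of x "x - m"] by (intro mult_left_mono) auto
    then show "- (C * norm x) \<le> f m + C * norm (x - m)" using bound[OF m] by (simp add: distrib_left)
  qed
  have p_le: "p x \<le> f m + C * norm (x - m)" if "m \<in> M" for x m
    unfolding p_def using bdd that by (rule cINF_lower)
  have le_p: "r \<le> p x" if "\<And>m. m \<in> M \<Longrightarrow> r \<le> f m + C * norm (x - m)" for r x
    unfolding p_def using M0 that by (intro cINF_greatest) auto
  have "sublinear p"
    unfolding sublinear_def
  proof (intro conjI allI impI)
    fix x y
    have "p (x + y) - (f n + C * norm (y - n)) \<le> p x" if n: "n \<in> M" for n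
    proof (rule le_p)
      fix m assume m: "m \<in> M"
      have "p (x + y) \<le> f (m + n) + C * norm (x + y - (m + n))" using m n M by (intro p_le subspace_add)
      also have "f (m + n) = f m + f n" using m n by (rule add)
      also have "x + y - (m + n) = (x - m) + (y - n)" by simp
      also have "C * norm ((x - m) + (y - n)) \<le> C * (norm (x - m) + norm (y - n))"
        using C by (intro mult_left_mono norm_triangle_ineq)
      finally show "p (x + y) - (f n + C * norm (y - n)) \<le> f m + C * norm (x - m)"
        by (simp add: algebra_simps)
    qed
    then have "p (x + y) - p x \<le> p y" by (intro le_p) (simp add: algebra_simps)
    then show "p (x + y) \<le> p x + p y" by simp
  next
    fix r :: real and x assume r: "0 \<le> r"
    show "p (r *\<^sub>R x) \<le> r * p x"
    proof (cases "r = 0")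
      case True
      then show ?thesis using p_le[OF M0, of 0] f0 by simp
    next
      case False
      then have r: "r > 0" using r by simp
      have "p (r *\<^sub>R x) / r \<le> p x"
      proof (rule le_p)
        fix m assume m: "m \<in> M"
        have "p (r *\<^sub>R x) \<le> f (r *\<^sub>R m) + C * norm (r *\<^sub>R x - r *\<^sub>R m)" using m M by (intro p_le subspace_scale)
        also have "\<dots> = r * (f m + C * norm (x - m))"
          using m r by (simp add: scaleR distrib_left flip: scaleR_diff_right)
        finally show "p (r *\<^sub>R x) / r \<le> f m + C * norm (x - m)" using r by (simp add: field_simps)
      qed
      then show ?thesis using r by (simp add: field_simps)
    qed
  qed
  then obtain g where g: "sublinear g" "g \<le> p" "\<And>h. sublinear h \<Longrightarrow> h \<le> g \<Longrightarrow> h = g"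
    using minimal_sublinear_exists by blast
  have lin: "linear g" using g(1,3) by (rule minimal_sublinear_linear)
  have gp: "g x \<le> p x" for x using g(2) by (simp add: le_fun_def)
  have gneg: "g (- x) = - g x" for x using lin by (rule linear_neg)
  show thesis
  proof (rule that[OF lin])
    fix x assume x: "x \<in> M"
    have "- x \<in> M" using x M by (rule subspace_neg[rotated])
    have "f (- x) = - f x" using scaleR[OF x, of "- 1"] by simp
    then show "g x = f x"
      using gp[of x] gp[of "- x"] p_le[OF x, of x] p_le[OF \<open>- x \<in> M\<close>, of "- x"] gneg[of x] by simp
  next
    fix x
    show "\<bar>g x\<bar> \<le> C * norm x"
      using gp[of x] gp[of "- x"] p_le[OF M0, of x] p_le[OF M0, of "- x"] gneg[of x] f0 by simp
  qed
qed


text \<open>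
  Over the complex numbers the real part of \<open>f\<close> is extended to a real functional \<open>g\<close>, and the extension
  of \<open>f\<close> is \<open>g x - \<i> g (\<i> x)\<close>; its norm bound follows by rotating its value to the positive real axis.
\<close>

lemma (in normed_space_over) hahn_banach:
  assumes M: "subspace M" and lin: "linear_on_subspace M scale (*) f"
    and bound: "\<And>x. x \<in> M \<Longrightarrow> norm (f x) \<le> C * norm x" and C: "0 \<le> C"
  obtains \<gamma> where "Vector_Spaces.linear scale (*) \<gamma>" "\<And>x. x \<in> M \<Longrightarrow> \<gamma> x = f x"
    "\<And>x. norm (\<gamma> x) \<le> C * norm x"
proof -
  have fadd: "f (x + y) = f x + f y" and fscale: "f (scale c x) = c * f x"
    if "x \<in> M" "y \<in> M" for x y c
    using lin that by (auto simp: linear_on_subspace_def)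
  have scaleR: "r *\<^sub>R x = scale (of_real r) x" for r x by (simp add: scale_of_real)
  have Mr: "Real_Vector_Spaces.subspace M"
    using M by (auto simp: Real_Vector_Spaces.subspace_def subspace_def scaleR)
  have vs: "Vector_Spaces.linear scale (*) \<gamma>"
    if "\<And>x y. \<gamma> (x + y) = \<gamma> x + \<gamma> y" "\<And>c x. \<gamma> (scale c x) = c * \<gamma> x" for \<gamma>
  proof -
    interpret K: vector_space "(*) :: 'k \<Rightarrow> 'k \<Rightarrow> 'k" by (rule normed_space_over.axioms(1)[OF normed_space_over_self])
    show ?thesis using that by unfold_locales
  qed
  consider (real) \<phi> :: "'k \<Rightarrow> real" where "isometric_field_iso \<phi>"
    | (complex) \<phi> :: "'k \<Rightarrow> complex" where "isometric_field_iso \<phi>"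
    using real_or_complex by blast
  then show thesis
  proof cases
    case real
    then have bij: "bij \<phi>" and add: "\<phi> (x + y) = \<phi> x + \<phi> y" and mult: "\<phi> (x * y) = \<phi> x * \<phi> y"
      and sc: "\<phi> (r *\<^sub>R x) = r *\<^sub>R \<phi> x" and nrm: "norm (\<phi> x) = norm x" for x y r
      by (auto simp: isometric_field_iso_def)
    have inv: "\<phi> (inv \<phi> t) = t" "inv \<phi> (\<phi> x) = x" for t x
      using bij by (simp_all add: bij_is_surj surj_f_inv_f bij_is_inj)
    have eqI: "x = y" if "\<phi> x = \<phi> y" for x y using that bij by (metis bij_pointE)
    obtain g where g: "linear g" "\<And>x. x \<in> M \<Longrightarrow> g x = \<phi> (f x)" "\<And>x. \<bar>g x\<bar> \<le> C * norm x"
    proof (rule hahn_banach_real[OF Mr _ _ _ C])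
      show "\<phi> (f (x + y)) = \<phi> (f x) + \<phi> (f y)" if "x \<in> M" "y \<in> M" for x y
        using that by (simp add: fadd add)
      show "\<phi> (f (r *\<^sub>R x)) = r * \<phi> (f x)" if "x \<in> M" for r x
        using sc[of r "f x"] fscale[OF that that, of "of_real r"] by (simp add: scaleR scaleR_conv_of_real)
      show "\<bar>\<phi> (f x)\<bar> \<le> C * norm x" if "x \<in> M" for x
        using bound[OF that] nrm[of "f x"] by simp
    qed (rule that)
    define \<gamma> where "\<gamma> x = inv \<phi> (g x)" for x
    have \<phi>\<gamma>: "\<phi> (\<gamma> x) = g x" for x by (simp add: \<gamma>_def inv)
    have c_real: "of_real (\<phi> c) = c" for c :: 'k
    proof (rule eqI)
      have "\<phi> 1 = 1" using mult[of 1 1] nrm[of 1] by (cases "\<phi> 1 = 0") auto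
      then show "\<phi> (of_real (\<phi> c)) = \<phi> c" using sc[of "\<phi> c" 1] by (simp add: of_real_def)
    qed
    show thesis
    proof (rule that)
      show "Vector_Spaces.linear scale (*) \<gamma>"
      proof (rule vs)
        show "\<gamma> (x + y) = \<gamma> x + \<gamma> y" for x y
          by (rule eqI) (simp add: \<phi>\<gamma> add linear_add[OF g(1)])
        show "\<gamma> (scale c x) = c * \<gamma> x" for c x
        proof (rule eqI)
          have "\<phi> (\<gamma> (scale c x)) = g (\<phi> c *\<^sub>R x)" by (simp add: \<phi>\<gamma> scaleR c_real)
          then show "\<phi> (\<gamma> (scale c x)) = \<phi> (c * \<gamma> x)" by (simp add: linear_scale[OF g(1)] mult \<phi>\<gamma>)
        qed
      qed
      show "\<gamma> x = f x" if "x \<in> M" for x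
        by (rule eqI) (simp add: \<phi>\<gamma> g(2) that)
      show "norm (\<gamma> x) \<le> C * norm x" for x
        using g(3)[of x] nrm[of "\<gamma> x"] by (simp add: \<phi>\<gamma>)
    qed
  next
    case complex
    then have bij: "bij \<phi>" and add: "\<phi> (x + y) = \<phi> x + \<phi> y" and mult: "\<phi> (x * y) = \<phi> x * \<phi> y"
      and sc: "\<phi> (r *\<^sub>R x) = r *\<^sub>R \<phi> x" and nrm: "norm (\<phi> x) = norm x" for x y r
      by (auto simp: isometric_field_iso_def)
    have inv: "\<phi> (inv \<phi> t) = t" "inv \<phi> (\<phi> x) = x" for t x
      using bij by (simp_all add: bij_is_surj surj_f_inv_f bij_is_inj)
    have eqI: "x = y" if "\<phi> x = \<phi> y" for x y using that bij by (metis bij_pointE)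
    have one: "\<phi> 1 = 1" using mult[of 1 1] nrm[of 1] by (cases "\<phi> 1 = 0") auto
    have of_real: "\<phi> (of_real r) = of_real r" for r using sc[of r 1] one by (simp add: of_real_def)
    define J where "J = inv \<phi> \<i>"
    have \<phi>J: "\<phi> J = \<i>" by (simp add: J_def inv)
    have JJ: "J * J = - 1"
    proof (rule eqI)
      have "\<phi> (- 1) = - 1" using of_real[of "- 1"] by simp
      then show "\<phi> (J * J) = \<phi> (- 1)" by (simp add: mult \<phi>J)
    qed
    have decomp: "c = of_real (Re (\<phi> c)) + of_real (Im (\<phi> c)) * J" for c :: 'k
      by (rule eqI) (simp add: add mult of_real \<phi>J complex_eq_iff)
    obtain g where g: "linear g" "\<And>x. x \<in> M \<Longrightarrow> g x = Re (\<phi> (f x))" "\<And>x. \<bar>g x\<bar> \<le> C * norm x"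
    proof (rule hahn_banach_real[OF Mr _ _ _ C])
      show "Re (\<phi> (f (x + y))) = Re (\<phi> (f x)) + Re (\<phi> (f y))" if "x \<in> M" "y \<in> M" for x y
        using that by (simp add: fadd add)
      show "Re (\<phi> (f (r *\<^sub>R x))) = r * Re (\<phi> (f x))" if "x \<in> M" for r x
        using sc[of r "f x"] fscale[OF that that, of "of_real r"] by (simp add: scaleR scaleR_conv_of_real)
      show "\<bar>Re (\<phi> (f x))\<bar> \<le> C * norm x" if "x \<in> M" for x
        using bound[OF that] abs_Re_le_cmod[of "\<phi> (f x)"] nrm[of "f x"] by simp
    qed (rule that)
    define \<gamma> where "\<gamma> x = inv \<phi> (Complex (g x) (- g (scale J x)))" for x
    have \<phi>\<gamma>: "\<phi> (\<gamma> x) = Complex (g x) (- g (scale J x))" for x by (simp add: \<gamma>_def inv)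
    have \<gamma>add: "\<gamma> (x + y) = \<gamma> x + \<gamma> y" for x y
      by (rule eqI) (simp add: \<phi>\<gamma> add linear_add[OF g(1)] scale_right_distrib complex_eq_iff)
    have \<gamma>real: "\<gamma> (scale (of_real r) x) = of_real r * \<gamma> x" for r x
    proof (rule eqI)
      have "scale J (scale (of_real r) x) = r *\<^sub>R scale J x" by (simp add: scaleR mult.commute)
      then show "\<phi> (\<gamma> (scale (of_real r) x)) = \<phi> (of_real r * \<gamma> x)"
        by (simp add: \<phi>\<gamma> mult of_real scale_of_real linear_scale[OF g(1)] complex_eq_iff)
    qed
    have \<gamma>J: "\<gamma> (scale J x) = J * \<gamma> x" for x
      by (rule eqI) (simp add: \<phi>\<gamma> mult \<phi>J JJ linear_neg[OF g(1)] complex_eq_iff)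
    have \<gamma>scale: "\<gamma> (scale c x) = c * \<gamma> x" for c x
    proof -
      have "scale c x = scale (of_real (Re (\<phi> c))) x + scale (of_real (Im (\<phi> c))) (scale J x)"
        by (subst decomp[of c]) (simp add: scale_left_distrib)
      then have "\<gamma> (scale c x) = (of_real (Re (\<phi> c)) + of_real (Im (\<phi> c)) * J) * \<gamma> x"
        by (simp add: \<gamma>add \<gamma>real \<gamma>J distrib_right mult.assoc del: scale_scale)
      then show ?thesis by (simp flip: decomp)
    qed
    show thesis
    proof (rule that[OF vs[OF \<gamma>add \<gamma>scale]])
      fix x assume x: "x \<in> M"
      have "scale J x \<in> M" using M x by (rule subspace_scale)
      then show "\<gamma> x = f x"
        by (intro eqI) (simp add: \<phi>\<gamma> g(2) x fscale mult \<phi>J complex_eq_iff)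
    next
      fix x
      define w where "w = \<phi> (\<gamma> x)"
      show "norm (\<gamma> x) \<le> C * norm x"
      proof (cases "w = 0")
        case True
        then show ?thesis using nrm[of "\<gamma> x"] C by (simp add: w_def)
      next
        case False
        define u where "u = inv \<phi> (cnj w / of_real (cmod w))"
        have \<phi>u: "\<phi> u = cnj w / of_real (cmod w)" by (simp add: u_def inv)
        have nu: "norm u = 1" using nrm[of u] False by (simp add: \<phi>u norm_divide)
        have "\<phi> (\<gamma> (scale u x)) = of_real (cmod w)"
          using False by (simp add: \<gamma>scale mult \<phi>u w_def[symmetric] complex_norm_square[symmetric] power2_eq_square field_simps)
        then have "g (scale u x) = cmod w" by (simp add: \<phi>\<gamma> complex_eq_iff)
        then have "cmod w \<le> C * norm (scale u x)" using g(3)[of "scale u x"] by simp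
        then show ?thesis using nrm[of "\<gamma> x"] nu by (simp add: w_def norm_scale)
      qed
    qed
  qed
qed

section \<open>Operator norms of the local factorisations\<close>

lemma linear_on_subspace_sum:
  assumes "linear_on_subspace M s1 s2 f" "module.subspace s1 M" "module s1"
    and "\<And>i. i < (n::nat) \<Longrightarrow> y i \<in> M"
  shows "f (\<Sum>i<n. s1 (c i) (y i)) = (\<Sum>i<n. s2 (c i) (f (y i)))"
proof -
  interpret module s1 by fact
  have M: "subspace M" by fact
  have add: "f (x + y) = f x + f y" and scale: "f (s1 c x) = s2 c (f x)" if "x \<in> M" "y \<in> M" for x y c
    using assms(1) that by (auto simp: linear_on_subspace_def)
  have "f 0 = f 0 + f 0" using add[OF subspace_0[OF M] subspace_0[OF M]] by simp
  then have f0: "f 0 = 0" by simp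
  have "k \<le> n \<Longrightarrow> f (\<Sum>i<k. s1 (c i) (y i)) = (\<Sum>i<k. s2 (c i) (f (y i)))" for k
  proof (induction k)
    case 0
    then show ?case by (simp add: f0)
  next
    case (Suc k)
    have "(\<Sum>i<k. s1 (c i) (y i)) \<in> M" "s1 (c k) (y k) \<in> M" "y k \<in> M"
      using assms(4) Suc.prems M by (auto intro!: subspace_sum subspace_scale)
    then show ?case using Suc by (simp add: add scale)
  qed
  then show ?thesis by blast
qed

lemma lq_norm_scale:
  assumes "0 < q"
  shows "lq_norm q n (lq_scale c v) = norm c * lq_norm q n v"
proof -
  have "(\<Sum>i<n. norm (c * v i) powr q) = norm c powr q * (\<Sum>i<n. norm (v i) powr q)"
    by (simp add: norm_mult powr_mult sum_distrib_left)
  then show ?thesis using assms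
    by (simp add: lq_norm_def lq_scale_def powr_mult powr_powr sum_nonneg)
qed

lemma norm_coordinate_le_lq_norm:
  assumes "0 < q" "i < n"
  shows "norm (v i) \<le> lq_norm q n v"
proof -
  have "(norm (v i) powr q) powr (1 / q) \<le> (\<Sum>i<n. norm (v i) powr q) powr (1 / q)"
    using assms by (intro powr_mono2 member_le_sum) auto
  then show ?thesis using assms by (simp add: powr_powr lq_norm_def)
qed

lemma cauchy_schwarz_coordinates:
  fixes a b :: "nat \<Rightarrow> 'k::real_or_complex"
  shows "norm (\<Sum>i<n. a i * b i) \<le> lq_norm 2 n a * lq_norm 2 n b"
proof -
  have "norm (\<Sum>i<n. a i * b i) \<le> (\<Sum>i<n. \<bar>norm (a i)\<bar> * \<bar>norm (b i)\<bar>)"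
    by (rule order_trans[OF norm_sum]) (simp add: norm_mult)
  also have "\<dots> \<le> L2_set (\<lambda>i. norm (a i)) {..<n} * L2_set (\<lambda>i. norm (b i)) {..<n}"
    by (rule L2_set_mult_ineq)
  finally show ?thesis by (simp add: L2_set_def lq_norm_two)
qed

text \<open>
  The norm of \<open>a\<close> is attained at the vector of its complex conjugates. These are written as
  \<open>\<bar>a i\<bar>\<^sup>2 / a i\<close>, which makes sense in every scalar field and gives zero where \<open>a i\<close> vanishes.
\<close>

lemma lq_norm_two_le_dual:
  fixes a :: "nat \<Rightarrow> 'k::real_or_complex"
  assumes "\<And>v. v \<in> lq_space n \<Longrightarrow> norm (\<Sum>i<n. v i * a i) \<le> \<sigma> * lq_norm 2 n v" and "0 \<le> \<sigma>"
  shows "lq_norm 2 n a \<le> \<sigma>"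
proof -
  define v where "v i = (if i < n then of_real ((norm (a i))\<^sup>2) / a i else 0)" for i
  have nv: "norm (v i) = norm (a i)" if "i < n" for i
    using that by (simp add: v_def norm_divide power2_eq_square norm_mult)
  have "v i * a i = of_real ((norm (a i))\<^sup>2)" if "i < n" for i
    using that by (simp add: v_def)
  then have sum: "(\<Sum>i<n. v i * a i) = of_real (\<Sum>i<n. (norm (a i))\<^sup>2)" by simp
  have nrm: "lq_norm 2 n v = lq_norm 2 n a" using nv by (simp add: lq_norm_two)
  have "v \<in> lq_space n" by (simp add: lq_space_def v_def)
  from assms(1)[OF this] have "\<bar>\<Sum>i<n. (norm (a i))\<^sup>2\<bar> \<le> \<sigma> * lq_norm 2 n a"
    unfolding sum nrm norm_of_real .
  then have "lq_norm 2 n a * lq_norm 2 n a \<le> \<sigma> * lq_norm 2 n a"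
    by (simp add: lq_norm_two sum_nonneg)
  then show ?thesis using assms(2) lq_norm_nonneg[of 2 n a]
    by (cases "lq_norm 2 n a = 0") (simp_all add: mult_le_cancel_right)
qed

definition unit_image :: "((nat \<Rightarrow> 'k::zero_neq_one) \<Rightarrow> 'e) \<Rightarrow> nat \<Rightarrow> 'e" where
  "unit_image S i = S (\<lambda>j. if j = i then 1 else 0)"

context normed_space_over
begin

text \<open>
  The operator norm is a supremum of reals, so it is meaningful only for a bounded set; each coordinate of
  \<open>R\<close> is a functional on a finite dimensional space, whence the set is bounded.
\<close>

lemma lq_norm_le_opnorm:
  assumes q: "0 < q" and B: "finite B" and lin: "linear_on_subspace (span B) scale lq_scale R"
  shows "x \<in> span B \<Longrightarrow> lq_norm q n (R x) \<le> opnorm_on (span B) norm (lq_norm q n) R * norm x"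
    and "0 \<le> opnorm_on (span B) norm (lq_norm q n) R"
proof -
  have coord: "linear_on_subspace (span B) scale (*) (\<lambda>x. R x i)" for i
    using lin by (simp add: linear_on_subspace_def lq_scale_def)
  have "\<exists>C\<ge>0. \<forall>x\<in>span B. norm (R x i) \<le> C * norm x" for i
    using functional_bounded_on_finite_span[OF B coord, of i] by metis
  then obtain C where C: "\<And>i. C i \<ge> 0" "\<And>i x. x \<in> span B \<Longrightarrow> norm (R x i) \<le> C i * norm x" by metis
  have bdd: "bdd_above ((\<lambda>x. lq_norm q n (R x)) ` {x \<in> span B. norm x \<le> 1})"
  proof (rule bdd_aboveI2)
    fix x assume "x \<in> {x \<in> span B. norm x \<le> 1}"
    then have x: "x \<in> span B" "norm x \<le> 1" by auto
    have "norm (R x i) \<le> C i" for i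
      using C(2)[OF x(1), of i] mult_left_mono[OF x(2) C(1), of i] by simp
    then show "lq_norm q n (R x) \<le> (\<Sum>i<n. C i powr q) powr (1 / q)"
      unfolding lq_norm_def using q by (intro powr_mono2 sum_mono) (auto intro: sum_nonneg)
  qed
  have le: "lq_norm q n (R x) \<le> opnorm_on (span B) norm (lq_norm q n) R" if "x \<in> span B" "norm x \<le> 1" for x
    unfolding opnorm_on_def using that by (intro cSUP_upper bdd) auto
  show "0 \<le> opnorm_on (span B) norm (lq_norm q n) R"
    by (rule order_trans[OF lq_norm_nonneg le[OF span_zero]]) simp
  assume x: "x \<in> span B"
  show "lq_norm q n (R x) \<le> opnorm_on (span B) norm (lq_norm q n) R * norm x"
  proof (cases "x = 0")
    case True
    then have "R x i = 0" for i using C(2)[OF x, of i] by simp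
    then show ?thesis using True q by (simp add: lq_norm_def)
  next
    case False
    let ?c = "of_real (1 / norm x)"
    have "lq_norm q n (R (scale ?c x)) \<le> opnorm_on (span B) norm (lq_norm q n) R"
      using x False by (intro le span_scale) (auto simp: norm_scale norm_divide)
    moreover have "R (scale ?c x) = lq_scale ?c (R x)"
      using lin x by (auto simp: linear_on_subspace_def)
    ultimately show ?thesis using False
      by (simp add: lq_norm_scale[OF q] norm_divide field_simps)
  qed
qed

lemma lq_space_expand:
  assumes lin: "linear_on_subspace (lq_space n) lq_scale scale S" and v: "v \<in> lq_space n"
  shows "S v = (\<Sum>i<n. scale (v i) (unit_image S i))"
proof -
  have add: "S (x + y) = S x + S y" and sc: "S (lq_scale c x) = scale c (S x)"
    if "x \<in> lq_space n" "y \<in> lq_space n" for x y c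
    using lin that by (auto simp: linear_on_subspace_def)
  have z: "(\<lambda>_. 0) \<in> lq_space n" by (simp add: lq_space_def)
  have "S (\<lambda>j. if j < k then v j else 0) = (\<Sum>i<k. scale (v i) (unit_image S i))" if "k \<le> n" for k
    using that
  proof (induction k)
    case 0
    have "S (lq_scale 0 (\<lambda>_. 0)) = scale 0 (S (\<lambda>_. 0))" by (rule sc[OF z z])
    then show ?case by (simp add: lq_scale_def)
  next
    case (Suc k)
    let ?u = "\<lambda>j. if j = k then 1 else 0"
    have u: "?u \<in> lq_space n" "lq_scale (v k) ?u \<in> lq_space n" "(\<lambda>j. if j < k then v j else 0) \<in> lq_space n"
      using Suc.prems by (auto simp: lq_space_def lq_scale_def)
    have "(\<lambda>j. if j < Suc k then v j else 0) = (\<lambda>j. if j < k then v j else 0) + lq_scale (v k) ?u"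
      by (auto simp: fun_eq_iff lq_scale_def less_Suc_eq)
    then have "S (\<lambda>j. if j < Suc k then v j else 0) = S (\<lambda>j. if j < k then v j else 0) + scale (v k) (S ?u)"
      by (simp only: add[OF u(3,2)] sc[OF u(1,1)])
    then show ?case using Suc by (simp add: unit_image_def)
  qed
  moreover have "(\<lambda>j. if j < n then v j else 0) = v" using v by (auto simp: lq_space_def fun_eq_iff)
  ultimately show ?thesis by (metis order_refl)
qed

lemma norm_le_opnorm:
  assumes q: "0 < q" and lin: "linear_on_subspace (lq_space n) lq_scale scale S"
  shows "v \<in> lq_space n \<Longrightarrow> norm (S v) \<le> opnorm_on (lq_space n) (lq_norm q n) norm S * lq_norm q n v"
    and "0 \<le> opnorm_on (lq_space n) (lq_norm q n) norm S"
proof -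
  have bdd: "bdd_above ((\<lambda>v. norm (S v)) ` {v \<in> lq_space n. lq_norm q n v \<le> 1})"
  proof (rule bdd_aboveI2)
    fix v :: "nat \<Rightarrow> 'k" assume "v \<in> {v \<in> lq_space n. lq_norm q n v \<le> 1}"
    then have v: "v \<in> lq_space n" "lq_norm q n v \<le> 1" by auto
    have "norm (S v) \<le> (\<Sum>i<n. norm (v i) * norm (unit_image S i))"
      unfolding lq_space_expand[OF lin v(1)] by (rule order_trans[OF norm_sum]) (simp add: norm_scale)
    also have "\<dots> \<le> (\<Sum>i<n. 1 * norm (unit_image S i))"
      using norm_coordinate_le_lq_norm[OF q, of _ n v] v(2)
      by (intro sum_mono mult_right_mono) (auto intro: order_trans)
    finally show "norm (S v) \<le> (\<Sum>i<n. norm (unit_image S i))" by simp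
  qed
  have le: "norm (S v) \<le> opnorm_on (lq_space n) (lq_norm q n) norm S" if "v \<in> lq_space n" "lq_norm q n v \<le> 1" for v
    unfolding opnorm_on_def using that by (intro cSUP_upper bdd) auto
  have "norm (S (\<lambda>_. 0)) \<le> opnorm_on (lq_space n) (lq_norm q n) norm S"
    using q by (intro le) (auto simp: lq_space_def lq_norm_def)
  then show "0 \<le> opnorm_on (lq_space n) (lq_norm q n) norm S" by (rule order_trans[OF norm_ge_zero])
  assume v: "v \<in> lq_space n"
  show "norm (S v) \<le> opnorm_on (lq_space n) (lq_norm q n) norm S * lq_norm q n v"
  proof (cases "lq_norm q n v = 0")
    case True
    then have "v i = 0" if "i < n" for i using norm_coordinate_le_lq_norm[OF q that, of v] by simp
    then show ?thesis using True by (simp add: lq_space_expand[OF lin v])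
  next
    case False
    then have pos: "lq_norm q n v > 0" using lq_norm_nonneg[of q n v] by linarith
    let ?c = "of_real (1 / lq_norm q n v)"
    have "norm (S (lq_scale ?c v)) \<le> opnorm_on (lq_space n) (lq_norm q n) norm S"
    proof (rule le)
      show "lq_scale ?c v \<in> lq_space n" using v by (simp add: lq_space_def lq_scale_def)
      show "lq_norm q n (lq_scale ?c v) \<le> 1" using pos by (simp add: lq_norm_scale[OF q] norm_divide)
    qed
    moreover have "S (lq_scale ?c v) = scale ?c (S v)"
      using lin v by (auto simp: linear_on_subspace_def)
    ultimately show ?thesis using pos by (simp add: norm_scale norm_divide field_simps)
  qed
qed

end


section \<open>Weak norms\<close>

context normed_space_over
begin

lemma linear_functionalI:
  assumes "\<And>x y. \<gamma> (x + y) = \<gamma> x + \<gamma> y" "\<And>c x. \<gamma> (scale c x) = c * \<gamma> x"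
  shows "Vector_Spaces.linear scale (*) \<gamma>"
  unfolding Vector_Spaces.linear_iff
  by (intro conjI allI assms vector_space_axioms normed_space_over.axioms(1)[OF normed_space_over_self])

lemma linear_functionalD:
  assumes "Vector_Spaces.linear scale (*) \<gamma>"
  shows "\<gamma> (x + y) = \<gamma> x + \<gamma> y" "\<gamma> (scale c x) = c * \<gamma> x" "\<gamma> (\<Sum>i\<in>I. f i) = (\<Sum>i\<in>I. \<gamma> (f i))"
    "\<gamma> (r *\<^sub>R x) = r *\<^sub>R \<gamma> x"
proof -
  interpret \<gamma>: module_hom scale "(*)" \<gamma> using assms by (simp add: module_hom_iff_linear)
  show "\<gamma> (x + y) = \<gamma> x + \<gamma> y" "\<gamma> (\<Sum>i\<in>I. f i) = (\<Sum>i\<in>I. \<gamma> (f i))"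
    by (rule \<gamma>.add, rule \<gamma>.sum)
  show *: "\<gamma> (scale c x) = c * \<gamma> x" for c by (rule \<gamma>.scale)
  show "\<gamma> (r *\<^sub>R x) = r *\<^sub>R \<gamma> x" using *[of "of_real r"] by (simp add: scale_of_real scaleR_conv_of_real)
qed

lemma dual_ballI:
  assumes "Vector_Spaces.linear scale (*) \<gamma>" "\<And>x. norm (\<gamma> x) \<le> norm x"
  shows "\<gamma> \<in> dual_ball scale"
proof -
  have "bounded_linear \<gamma>"
    using linear_functionalD[OF assms(1)] assms(2) by (intro bounded_linear_intro[of _ 1]) auto
  moreover have "onorm \<gamma> \<le> 1" using assms(2) by (intro onorm_bound) auto
  ultimately show ?thesis using assms(1) by (simp add: dual_ball_def)
qed

lemma dual_ballD:
  assumes "\<gamma> \<in> dual_ball scale"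
  shows "Vector_Spaces.linear scale (*) \<gamma>" "norm (\<gamma> x) \<le> norm x"
proof -
  have *: "bounded_linear \<gamma>" "onorm \<gamma> \<le> 1" using assms by (auto simp: dual_ball_def)
  show "Vector_Spaces.linear scale (*) \<gamma>" using assms by (simp add: dual_ball_def)
  have "norm (\<gamma> x) \<le> onorm \<gamma> * norm x" using *(1) by (rule onorm)
  also have "\<dots> \<le> 1 * norm x" using *(2) by (rule mult_right_mono) simp
  finally show "norm (\<gamma> x) \<le> norm x" by simp
qed

lemma zero_in_dual_ball: "(\<lambda>_. 0) \<in> dual_ball scale"
  by (rule dual_ballI, rule linear_functionalI) simp_all

lemma weak_norm_upper:
  assumes p: "0 < p" and \<gamma>: "\<gamma> \<in> dual_ball scale"
  shows "(\<Sum>j<J. norm (\<gamma> (y j)) powr p) powr (1 / p) \<le> weak_norm scale p J y"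
  unfolding weak_norm_def
proof (rule cSUP_upper[OF \<gamma>], rule bdd_aboveI2)
  fix \<gamma> assume "\<gamma> \<in> dual_ball scale"
  then show "(\<Sum>j<J. norm (\<gamma> (y j)) powr p) powr (1 / p) \<le> (\<Sum>j<J. norm (y j) powr p) powr (1 / p)"
    using p dual_ballD(2) by (intro powr_mono2 sum_mono) (auto intro: sum_nonneg)
qed

lemma weak_norm_nonneg: "0 < p \<Longrightarrow> 0 \<le> weak_norm scale p J y"
  by (rule order_trans[OF powr_ge_zero weak_norm_upper[OF _ zero_in_dual_ball]])

text \<open>
  Homogeneity of the weak norm, by which a functional of norm at most \<open>C\<close> need not be normalised.
\<close>

lemma functional_powr_sum_le_weak_norm:
  assumes p: "0 < p" and C: "0 \<le> C" and lin: "Vector_Spaces.linear scale (*) \<gamma>"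
    and bound: "\<And>x. norm (\<gamma> x) \<le> C * norm x"
  shows "(\<Sum>j<J. norm (\<gamma> (y j)) powr p) \<le> (C * weak_norm scale p J y) powr p"
proof (cases "C = 0")
  case True
  then have "\<gamma> x = 0" for x using bound[of x] by simp
  then show ?thesis using p by simp
next
  case False
  then have C: "C > 0" using C by simp
  let ?\<gamma> = "\<lambda>x. of_real (1 / C) * \<gamma> x"
  have "?\<gamma> \<in> dual_ball scale"
    using C bound linear_functionalD[OF lin]
    by (intro dual_ballI linear_functionalI) (auto simp: algebra_simps norm_mult norm_divide divide_le_eq)
  then have "(\<Sum>j<J. norm (?\<gamma> (y j)) powr p) powr (1 / p) \<le> weak_norm scale p J y"
    by (rule weak_norm_upper[OF p])
  then have "((\<Sum>j<J. norm (?\<gamma> (y j)) powr p) powr (1 / p)) powr p \<le> weak_norm scale p J y powr p"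
    using p by (intro powr_mono2) auto
  then have "(\<Sum>j<J. norm (?\<gamma> (y j)) powr p) \<le> weak_norm scale p J y powr p"
    using p by (simp add: powr_powr sum_nonneg)
  moreover have "(\<Sum>j<J. norm (\<gamma> (y j)) powr p) = C powr p * (\<Sum>j<J. norm (?\<gamma> (y j)) powr p)"
    using C by (simp add: norm_mult norm_divide powr_divide sum_distrib_left)
  ultimately show ?thesis using C weak_norm_nonneg[OF p] by (simp add: powr_mult)
qed

lemma weak_norm_least:
  assumes p: "0 < p" and W: "0 \<le> W"
    and "\<And>\<gamma>. \<gamma> \<in> dual_ball scale \<Longrightarrow> (\<Sum>j<J. norm (\<gamma> (y j)) powr p) \<le> W powr p"
  shows "weak_norm scale p J y \<le> W"
  unfolding weak_norm_def
proof (rule cSUP_least)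
  show "dual_ball scale \<noteq> {}" using zero_in_dual_ball by blast
  fix \<gamma> assume "\<gamma> \<in> dual_ball scale"
  then have "(\<Sum>j<J. norm (\<gamma> (y j)) powr p) powr (1 / p) \<le> (W powr p) powr (1 / p)"
    using p assms(3) by (intro powr_mono2) (auto intro: sum_nonneg)
  then show "(\<Sum>j<J. norm (\<gamma> (y j)) powr p) powr (1 / p) \<le> W" using p W by (simp add: powr_powr)
qed

text \<open>
  A functional \<open>a\<close> on \<open>\<ell>\<^sub>2\<^sup>n\<close> composed with \<open>R\<close> is defined on the span only. Its Hahn-Banach extension is tested
  by the weak norm of \<open>x\<close>, which is taken in the whole space.
\<close>

lemma coordinates_weakly_summable:
  assumes p: "0 < p" and B: "finite B" and lin: "linear_on_subspace (span B) scale lq_scale R"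
    and x: "\<And>j. j < J \<Longrightarrow> x j \<in> span B"
  shows "(\<Sum>j<J. norm (\<Sum>i<n. R (x j) i * a i) powr p)
    \<le> (opnorm_on (span B) norm (lq_norm 2 n) R * weak_norm scale p J x * lq_norm 2 n a) powr p"
proof -
  let ?r = "opnorm_on (span B) norm (lq_norm 2 n) R"
  have r: "0 \<le> ?r" using lq_norm_le_opnorm(2)[OF _ B lin, of 2] by simp
  have "linear_on_subspace (span B) scale (*) (\<lambda>x. \<Sum>i<n. R x i * a i)"
    using lin by (auto simp: linear_on_subspace_def lq_scale_def distrib_right sum.distrib sum_distrib_left mult.assoc)
  moreover have "norm (\<Sum>i<n. R x i * a i) \<le> (?r * lq_norm 2 n a) * norm x" if "x \<in> span B" for x
  proof -
    have "norm (\<Sum>i<n. R x i * a i) \<le> lq_norm 2 n (R x) * lq_norm 2 n a" by (rule cauchy_schwarz_coordinates)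
    also have "\<dots> \<le> (?r * norm x) * lq_norm 2 n a"
      using lq_norm_le_opnorm(1)[OF _ B lin that, of 2 n] by (intro mult_right_mono) auto
    finally show ?thesis by (simp add: mult_ac)
  qed
  ultimately obtain \<gamma> where \<gamma>: "Vector_Spaces.linear scale (*) \<gamma>"
    "\<And>x. x \<in> span B \<Longrightarrow> \<gamma> x = (\<Sum>i<n. R x i * a i)" "\<And>x. norm (\<gamma> x) \<le> (?r * lq_norm 2 n a) * norm x"
    using hahn_banach[OF subspace_span, of B "\<lambda>x. \<Sum>i<n. R x i * a i" "?r * lq_norm 2 n a"] r by auto
  have "(\<Sum>j<J. norm (\<Sum>i<n. R (x j) i * a i) powr p) = (\<Sum>j<J. norm (\<gamma> (x j)) powr p)"
    using \<gamma>(2) x by (intro sum.cong) auto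
  also have "\<dots> \<le> ((?r * lq_norm 2 n a) * weak_norm scale p J x) powr p"
    using r \<gamma> by (intro functional_powr_sum_le_weak_norm p) auto
  finally show ?thesis by (simp add: mult_ac)
qed

text \<open>
  A functional of norm one composed with \<open>S\<close> is a functional on \<open>\<ell>\<^sub>2\<^sup>n\<close> of norm at most that of \<open>S\<close>, so
  Khinchine's inequality applies to its coordinates.
\<close>

lemma weak_norm_rademacher_le:
  assumes p: "0 < p" and lin: "linear_on_subspace (lq_space n) lq_scale scale S"
    and B: "0 \<le> B" "\<And>a :: nat \<Rightarrow> 'k. mean {..<2 ^ n} (\<lambda>j. norm (\<Sum>i<n. rad j i *\<^sub>R a i) powr p) \<le> B * lq_norm 2 n a powr p"
  shows "weak_norm scale p (2 ^ n) (\<lambda>j. \<Sum>i<n. rad j i *\<^sub>R unit_image S i)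
    \<le> (2 ^ n * B) powr (1 / p) * opnorm_on (lq_space n) (lq_norm 2 n) norm S"
proof (rule weak_norm_least[OF p])
  let ?s = "opnorm_on (lq_space n) (lq_norm 2 n) norm S"
  have s: "0 \<le> ?s" using norm_le_opnorm(2)[OF _ lin, of 2] by simp
  then show "0 \<le> (2 ^ n * B) powr (1 / p) * ?s" by simp
  fix \<gamma> assume "\<gamma> \<in> dual_ball scale"
  note \<gamma> = dual_ballD[OF this]
  note \<gamma>lin = linear_functionalD[OF \<gamma>(1)]
  have "lq_norm 2 n (\<lambda>i. \<gamma> (unit_image S i)) \<le> ?s"
  proof (rule lq_norm_two_le_dual[OF _ s])
    fix v :: "nat \<Rightarrow> 'k" assume v: "v \<in> lq_space n"
    have "(\<Sum>i<n. v i * \<gamma> (unit_image S i)) = \<gamma> (S v)"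
      by (simp add: lq_space_expand[OF lin v] \<gamma>lin)
    then show "norm (\<Sum>i<n. v i * \<gamma> (unit_image S i)) \<le> ?s * lq_norm 2 n v"
      using \<gamma>(2)[of "S v"] norm_le_opnorm(1)[OF _ lin v, of 2] by simp
  qed
  then have "B * lq_norm 2 n (\<lambda>i. \<gamma> (unit_image S i)) powr p \<le> B * ?s powr p"
    using p B by (intro mult_left_mono powr_mono2) auto
  with B(2)[of "\<lambda>i. \<gamma> (unit_image S i)"]
  have "mean {..<2 ^ n} (\<lambda>j. norm (\<Sum>i<n. rad j i *\<^sub>R \<gamma> (unit_image S i)) powr p) \<le> B * ?s powr p" by linarith
  then have "(\<Sum>j<2 ^ n. norm (\<gamma> (\<Sum>i<n. rad j i *\<^sub>R unit_image S i)) powr p) \<le> 2 ^ n * B * ?s powr p"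
    by (simp add: mean_def \<gamma>lin divide_le_eq mult_ac)
  then show "(\<Sum>j<2 ^ n. norm (\<gamma> (\<Sum>i<n. rad j i *\<^sub>R unit_image S i)) powr p) \<le> ((2 ^ n * B) powr (1 / p) * ?s) powr p"
    using p B s by (simp add: powr_mult powr_powr)
qed

end

section \<open>Multilinear maps between spaces with local structure\<close>

lemma multilinear_coordinate_sum:
  assumes "multilinear sE sF T"
  shows "T (z(k := \<Sum>i\<in>I. sE (c i) (b i))) = (\<Sum>i\<in>I. sF (c i) (T (z(k := b i))))"
proof -
  interpret module_hom sE sF "\<lambda>y. T (z(k := y))"
    using assms by (simp add: multilinear_def module_hom_iff_linear)
  show ?thesis by (simp add: sum scale)
qed

text \<open>
  Thus the values of \<open>T\<close> on a finite dimensional subspace span a finite dimensional subspace, to which the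
  local structure of the target applies. The proof expands the variables in a set \<open>A\<close>, while the others are
  basis vectors.
\<close>

lemma multilinear_in_span:
  fixes T :: "('m::finite \<Rightarrow> 'e::real_normed_vector) \<Rightarrow> 'f::real_normed_vector"
  assumes T: "multilinear sE sF T" and sF: "normed_space_over sF"
    and z: "\<And>k. \<exists>c. z k = (\<Sum>i<n. sE (c i) (b i))"
  shows "T z \<in> module.span sF ((\<lambda>i. T (\<lambda>k. b (i k))) ` multi_indices (\<lambda>_. n))"
proof -
  interpret F: normed_space_over sF by fact
  let ?M = "F.span ((\<lambda>i. T (\<lambda>k. b (i k))) ` multi_indices (\<lambda>_. n))"
  have "T z \<in> ?M" if "\<And>k. k \<in> A \<Longrightarrow> \<exists>c. z k = (\<Sum>i<n. sE (c i) (b i))"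
    "\<And>k. k \<notin> A \<Longrightarrow> z k \<in> b ` {..<n}" for A z
    using that
  proof (induction A arbitrary: z rule: finite_induct[OF finite])
    case 1
    then have "\<forall>k. \<exists>i<n. z k = b i" by auto
    then obtain i where "\<And>k. i k < n" "\<And>k. z k = b (i k)" by metis
    then have z: "z = (\<lambda>k. b (i k))" and "i \<in> multi_indices (\<lambda>_. n)" by (auto simp: multi_indices_def)
    then show ?case unfolding z by (intro F.span_base imageI)
  next
    case (2 k A)
    obtain c where c: "z k = (\<Sum>i<n. sE (c i) (b i))" using 2(4) by blast
    have "T z = T (z(k := \<Sum>i<n. sE (c i) (b i)))" by (simp flip: c)
    also have "\<dots> = (\<Sum>i<n. sF (c i) (T (z(k := b i))))" by (rule multilinear_coordinate_sum[OF T])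
    also have "\<dots> \<in> ?M"
    proof (intro F.span_sum F.span_scale "2.IH")
      fix i l assume i: "i \<in> {..<n}"
      show "\<exists>c. (z(k := b i)) l = (\<Sum>i<n. sE (c i) (b i))" if "l \<in> A"
        using 2 that by auto
      show "(z(k := b i)) l \<in> b ` {..<n}" if "l \<notin> A"
        using 2(5) that i by auto
    qed
    finally show ?case .
  qed
  from this[of UNIV z] show ?thesis using z by auto
qed

lemma Lg_const_spaceE:
  assumes "Lg_const_space sE q L" and "normed_space_over sE" and "finite B"
  obtains n R S where "linear_on_subspace (module.span sE B) sE lq_scale R" "R ` module.span sE B \<subseteq> lq_space n"
    "linear_on_subspace (lq_space n) lq_scale sE S" "\<And>x. x \<in> module.span sE B \<Longrightarrow> S (R x) = x"
    "opnorm_on (lq_space n) (lq_norm q n) norm S * opnorm_on (module.span sE B) norm (lq_norm q n) R \<le> L + 1"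
proof -
  interpret normed_space_over sE by fact
  have "subspace (span B) \<and> (\<exists>B'. finite B' \<and> span B = span B') \<and> (1::real) > 0" using assms(3) by auto
  from assms(1)[unfolded Lg_const_space_def, rule_format, OF this] that show thesis by blast
qed

text \<open>
  The maps \<open>R, S\<close> factor the span of the given vectors through \<open>\<ell>\<^sub>2\<^sup>n\<close>, and \<open>R', S'\<close> factor the values of \<open>T\<close>
  through \<open>\<ell>\<^sub>q\<^sup>N\<close>, so that \<open>F\<close>, the norm of \<open>T\<close> seen in \<open>\<ell>\<^sub>q\<^sup>N\<close>, is a function to which the three
  estimates apply. The number \<open>\<nu> = 2\<^sup>n\<close> of sign sums cancels: replacing the given vectors costs
  \<open>\<nu>\<^bsup>-m\<^esup>\<close>, which turns the sum over signs into a mean, and the weak norm of the sign sums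
  contributes \<open>\<nu>\<^bsup>1/s\<^esup>\<close> for each variable. The norms enter only as \<open>\<sigma> r\<close> and \<open>\<sigma>' r'\<close>.
\<close>

lemma multiple_summing_subset:
  fixes sY :: "'k::real_or_complex \<Rightarrow> 'y::real_normed_vector \<Rightarrow> 'y"
    and sX :: "'k \<Rightarrow> 'x::real_normed_vector \<Rightarrow> 'x"
    and s P q :: real
  assumes Y: "normed_space_over sY" and X: "normed_space_over sX"
    and q: "0 < q" and s: "0 < s" and P: "q \<le> P"
    and LY: "Lg_space sY 2" and LX: "Lg_space sX q"
  shows "(multiple_summing sY sX s :: (('m::finite \<Rightarrow> 'y) \<Rightarrow> 'x) set) \<subseteq> multiple_summing sY sX P"
proof
  fix T :: "('m \<Rightarrow> 'y) \<Rightarrow> 'x"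
  assume "T \<in> multiple_summing sY sX s"
  then obtain C0 where T: "multilinear sY sX T" "continuous_on UNIV T" and C0: "C0 > 0"
    "\<And>(J :: 'm \<Rightarrow> nat) x. (\<Sum>j\<in>multi_indices J. norm (T (\<lambda>k. x k (j k))) powr s) powr (1 / s)
       \<le> C0 * (\<Prod>k\<in>UNIV. weak_norm sY s (J k) (x k))"
    unfolding multiple_summing_def multi_indices_def by blast
  interpret Y: normed_space_over sY by fact
  interpret X: normed_space_over sX by fact
  have P0: "P > 0" using q P by simp
  obtain LY LX where LY: "LY \<ge> 1" "Lg_const_space sY 2 LY" and LX: "LX \<ge> 1" "Lg_const_space sX q LX"
    using assms(6,7) unfolding Lg_space_def by blast
  obtain C1 where C1: "C1 > 0"
    "\<And>n N (J :: nat) W (u :: nat \<Rightarrow> nat \<Rightarrow> 'k) c.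
      0 \<le> W \<Longrightarrow> \<forall>a. (\<Sum>j<J. norm (\<Sum>i<n. c j i * a i) powr P) \<le> (W * lq_norm 2 n a) powr P \<Longrightarrow>
      (\<Sum>j<J. lq_norm q N (\<lambda>t. \<Sum>i<n. c j i * u t i) powr P)
        \<le> C1 * W powr P * mean {..<2 ^ n} (\<lambda>j. lq_norm q N (\<lambda>t. \<Sum>i<n. rad j i *\<^sub>R u t i) powr q) powr (P / q)"
    using lq_summing_bound[OF q P, where 'k = 'k] by blast
  obtain B where B: "B > 0"
    "\<And>n (a :: nat \<Rightarrow> 'k). mean {..<2 ^ n} (\<lambda>j. norm (\<Sum>i<n. rad j i *\<^sub>R a i) powr s) \<le> B * lq_norm 2 n a powr s"
    by (rule khinchine_upper[OF s]) (rule that)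
  obtain K where K: "K > 0"
    "\<And>n (e :: nat \<Rightarrow> 'y) D (F :: ('m \<Rightarrow> 'y) \<Rightarrow> real).
    \<forall>i<2 ^ n. e i \<in> D \<Longrightarrow> \<forall>z. 0 \<le> F z \<Longrightarrow>
    \<forall>k z. (\<forall>l. l \<noteq> k \<longrightarrow> z l \<in> D) \<longrightarrow>
       (\<exists>N (u :: nat \<Rightarrow> nat \<Rightarrow> 'k). \<forall>i<2 ^ n. F (z(k := e i)) = lq_norm q N (\<lambda>t. \<Sum>l<n. rad i l *\<^sub>R u t l)) \<Longrightarrow>
    mean (multi_indices (\<lambda>_. 2 ^ n)) (\<lambda>j. F (\<lambda>k. e (j k)) powr P)
      \<le> K * mean (multi_indices (\<lambda>_. 2 ^ n)) (\<lambda>j. F (\<lambda>k. e (j k)) powr s) powr (P / s)"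
    using multilinear_kahane[OF q P s, where 'k = 'k and 'm = 'm and 'e = 'y] by blast
  define m where "m = CARD('m)"
  define G where "G = K * C1 ^ m * (B ^ m) powr (P / s)"
  have G: "G > 0" using K(1) C1(1) B(1) by (simp add: G_def)
  define C where "C = G powr (1 / P) * (C0 * (LX + 1) * (LY + 1) ^ m)"
  have main: "(\<Sum>j\<in>multi_indices J. norm (T (\<lambda>k. x k (j k))) powr P) powr (1 / P)
     \<le> C * (\<Prod>k\<in>UNIV. weak_norm sY P (J k) (x k))" for J :: "'m \<Rightarrow> nat" and x
  proof -
    define BY where "BY = (\<Union>k. x k ` {..<J k})"
    have BY: "finite BY" by (simp add: BY_def)
    obtain n R S where R: "linear_on_subspace (Y.span BY) sY lq_scale R" "R ` Y.span BY \<subseteq> lq_space n"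
      and S: "linear_on_subspace (lq_space n) lq_scale sY S" and SR: "\<And>x. x \<in> Y.span BY \<Longrightarrow> S (R x) = x"
      and rs: "opnorm_on (lq_space n) (lq_norm 2 n) norm S * opnorm_on (Y.span BY) norm (lq_norm 2 n) R \<le> LY + 1"
      by (rule Lg_const_spaceE[OF LY(2) Y BY]) (rule that)
    define r where "r = opnorm_on (Y.span BY) norm (lq_norm 2 n) R"
    define \<sigma> where "\<sigma> = opnorm_on (lq_space n) (lq_norm 2 n) norm S"
    have r0: "r \<ge> 0" unfolding r_def by (rule Y.lq_norm_le_opnorm(2)[OF _ BY R(1)]) simp
    have \<sigma>0: "\<sigma> \<ge> 0" unfolding \<sigma>_def by (rule Y.norm_le_opnorm(2)[OF _ S]) simp
    define b where "b = unit_image S"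
    define D where "D = {y. \<exists>c. y = (\<Sum>i<n. sY (c i) (b i))}"
    have D_I: "y \<in> D" if "y = (\<Sum>i<n. sY (c i) (b i))" for y c
      unfolding D_def using that by (intro CollectI exI)
    define e where "e i = (\<Sum>l<n. rad i l *\<^sub>R b l)" for i
    have e_sum: "e i = (\<Sum>l<n. sY (of_real (rad i l)) (b l))" for i by (simp add: e_def Y.scale_of_real)
    then have eD: "e i \<in> D" for i by (rule D_I)
    have bD: "b i \<in> D" if "i < n" for i
    proof -
      have "b i = (\<Sum>l<n. sY (if l = i then 1 else 0) (b l))"
        using that by (simp add: if_distrib[of "\<lambda>c. sY c _"] cong: if_cong)
      then show ?thesis by (rule D_I)
    qed
    have x_span: "x k i \<in> Y.span BY" if "i < J k" for k i
      using that by (intro Y.span_base) (auto simp: BY_def)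
    have x_sum: "x k i = (\<Sum>l<n. sY (R (x k i) l) (b l))" if "i < J k" for k i
    proof -
      have "R (x k i) \<in> lq_space n" by (rule subsetD[OF R(2) imageI[OF x_span[OF that]]])
      from Y.lq_space_expand[OF S this] show ?thesis by (simp add: SR[OF x_span[OF that]] b_def)
    qed
    have xD: "x k i \<in> D" if "i < J k" for k i by (rule D_I[OF x_sum[OF that]])
    \<comment> \<open>\<open>T\<close> maps the image of \<open>\<ell>\<^sub>2\<^sup>n\<close> into the span of its values at the vectors \<open>b i\<close>\<close>
    define BX where "BX = (\<lambda>i :: 'm \<Rightarrow> nat. T (\<lambda>k. b (i k))) ` multi_indices (\<lambda>_. n)"
    have BX: "finite BX" by (simp add: BX_def)
    have TD: "T z \<in> X.span BX" if "\<And>k. z k \<in> D" for z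
      unfolding BX_def by (rule multilinear_in_span[OF T(1) X]) (use that in \<open>auto simp: D_def\<close>)
    obtain N R' S' where R': "linear_on_subspace (X.span BX) sX lq_scale R'" "R' ` X.span BX \<subseteq> lq_space N"
      and S': "linear_on_subspace (lq_space N) lq_scale sX S'" and SR': "\<And>x. x \<in> X.span BX \<Longrightarrow> S' (R' x) = x"
      and rs': "opnorm_on (lq_space N) (lq_norm q N) norm S' * opnorm_on (X.span BX) norm (lq_norm q N) R' \<le> LX + 1"
      by (rule Lg_const_spaceE[OF LX(2) X BX]) (rule that)
    define r' where "r' = opnorm_on (X.span BX) norm (lq_norm q N) R'"
    define \<sigma>' where "\<sigma>' = opnorm_on (lq_space N) (lq_norm q N) norm S'"
    have r'0: "r' \<ge> 0" unfolding r'_def by (rule X.lq_norm_le_opnorm(2)[OF q BX R'(1)])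
    have \<sigma>'0: "\<sigma>' \<ge> 0" unfolding \<sigma>'_def by (rule X.norm_le_opnorm(2)[OF q S'])
    define F where "F z = lq_norm q N (R' (T z))" for z
    have F0: "F z \<ge> 0" for z by (simp add: F_def)
    have F_le: "F z \<le> r' * norm (T z)" if "\<And>k. z k \<in> D" for z
      unfolding F_def r'_def by (rule X.lq_norm_le_opnorm(1)[OF q BX R'(1) TD[OF that]])
    have le_F: "norm (T z) \<le> \<sigma>' * F z" if "\<And>k. z k \<in> D" for z
    proof -
      have "R' (T z) \<in> lq_space N" by (rule subsetD[OF R'(2) imageI[OF TD[OF that]]])
      from X.norm_le_opnorm(1)[OF q S' this] show ?thesis
        by (simp add: SR'[OF TD[OF that]] F_def \<sigma>'_def)
    qed
    \<comment> \<open>as a map of its variable \<open>k\<close> alone, \<open>T\<close> becomes a matrix \<open>u\<close> from \<open>\<ell>\<^sub>2\<^sup>n\<close> to \<open>\<ell>\<^sub>q\<^sup>N\<close>\<close>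
    have rep: "\<exists>u. \<forall>c. F (z(k := \<Sum>i<n. sY (c i) (b i))) = lq_norm q N (\<lambda>t. \<Sum>i<n. c i * u t i)"
      if z: "\<And>l. l \<noteq> k \<Longrightarrow> z l \<in> D" for k z
    proof (intro exI allI)
      fix c
      have "R' (T (z(k := \<Sum>i<n. sY (c i) (b i)))) t = (\<Sum>i<n. c i * R' (T (z(k := b i))) t)" for t
        unfolding multilinear_coordinate_sum[OF T(1)]
      proof (rule linear_on_subspace_sum[where f = "\<lambda>x. R' x t", OF _ X.subspace_span X.module_axioms])
        show "linear_on_subspace (X.span BX) sX (*) (\<lambda>x. R' x t)"
          using R'(1) by (simp add: linear_on_subspace_def lq_scale_def)
        show "T (z(k := b i)) \<in> X.span BX" if "i < n" for i
          by (rule TD) (use z bD[OF that] in auto)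
      qed
      then show "F (z(k := \<Sum>i<n. sY (c i) (b i))) = lq_norm q N (\<lambda>t. \<Sum>i<n. c i * R' (T (z(k := b i))) t)"
        by (simp add: F_def lq_norm_def)
    qed
    define w where "w k = weak_norm sY P (J k) (x k)" for k
    have w0: "w k \<ge> 0" for k unfolding w_def by (rule Y.weak_norm_nonneg[OF P0])
    define \<nu> :: real where "\<nu> = 2 ^ n"
    have \<nu>: "\<nu> > 0" by (simp add: \<nu>_def)
    let ?I = "multi_indices (\<lambda>_ :: 'm. 2 ^ n)"
    have "(\<Sum>j\<in>multi_indices J. F (\<lambda>k. x k (j k)) powr P)
      \<le> (\<Prod>k\<in>UNIV. C1 * (r * w k) powr P / \<nu>) * (\<Sum>j\<in>?I. F (\<lambda>k. e (j k)) powr P)"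
    proof (rule sum_replace_coordinates)
      fix k and z :: "'m \<Rightarrow> 'y" assume z: "\<And>l. l \<noteq> k \<Longrightarrow> z l \<in> D"
      from rep[OF z] obtain u where
        "\<forall>c. F (z(k := \<Sum>i<n. sY (c i) (b i))) = lq_norm q N (\<lambda>t. \<Sum>i<n. c i * u t i)" ..
      note u = this[THEN spec]
      have Fe: "F (z(k := e j)) = lq_norm q N (\<lambda>t. \<Sum>i<n. rad j i *\<^sub>R u t i)" for j
        unfolding e_sum u by (simp add: scaleR_conv_of_real)
      have "(\<Sum>i<J k. F (z(k := x k i)) powr P) = (\<Sum>i<J k. lq_norm q N (\<lambda>t. \<Sum>l<n. R (x k i) l * u t l) powr P)"
      proof (rule sum.cong)
        fix i assume "i \<in> {..<J k}"
        then have "i < J k" by simp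
        from u[of "R (x k i)", folded x_sum[OF this]]
        show "F (z(k := x k i)) powr P = lq_norm q N (\<lambda>t. \<Sum>l<n. R (x k i) l * u t l) powr P" by (rule arg_cong)
      qed simp
      also have "\<dots> \<le> C1 * (r * w k) powr P * mean {..<2 ^ n} (\<lambda>j. F (z(k := e j)) powr q) powr (P / q)"
        unfolding Fe
      proof (rule C1(2))
        show "0 \<le> r * w k" using r0 w0 by simp
        show "\<forall>a. (\<Sum>j<J k. norm (\<Sum>i<n. R (x k j) i * a i) powr P) \<le> (r * w k * lq_norm 2 n a) powr P"
          unfolding r_def w_def by (intro allI Y.coordinates_weakly_summable[OF P0 BY R(1)] x_span)
      qed
      also have "\<dots> \<le> C1 * (r * w k) powr P * (mean {..<2 ^ n} (\<lambda>j. F (z(k := e j)) powr P) powr (q / P)) powr (P / q)"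
        using q P F0 C1(1) by (intro mult_left_mono powr_mono2 power_mean_le mean_nonneg) (auto simp: lessThan_empty_iff)
      also have "\<dots> = C1 * (r * w k) powr P / \<nu> * (\<Sum>j<2 ^ n. F (z(k := e j)) powr P)"
        using q P by (simp add: powr_powr mean_nonneg) (simp add: mean_def \<nu>_def)
      finally show "(\<Sum>i<J k. F (z(k := x k i)) powr P) \<le> C1 * (r * w k) powr P / \<nu> * (\<Sum>j<2 ^ n. F (z(k := e j)) powr P)" .
    qed (use xD eD C1(1) \<nu> in auto)
    also have "(\<Prod>k\<in>UNIV. C1 * (r * w k) powr P / \<nu>) = C1 ^ m * (r ^ m * (\<Prod>k\<in>UNIV. w k)) powr P / \<nu> ^ m"
    proof -
      have "(\<Prod>k\<in>UNIV. (r * w k) powr P) = (\<Prod>k\<in>UNIV. r * w k) powr P"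
        using r0 w0 by (simp add: prod_powr_distrib)
      then show ?thesis by (simp add: prod.distrib prod_dividef m_def)
    qed
    finally have 1: "(\<Sum>j\<in>multi_indices J. F (\<lambda>k. x k (j k)) powr P)
      \<le> C1 ^ m * (r ^ m * (\<Prod>k\<in>UNIV. w k)) powr P * mean ?I (\<lambda>j. F (\<lambda>k. e (j k)) powr P)"
      by (simp add: mean_def card_multi_indices \<nu>_def m_def)
    have 2: "mean ?I (\<lambda>j. F (\<lambda>k. e (j k)) powr P) \<le> K * mean ?I (\<lambda>j. F (\<lambda>k. e (j k)) powr s) powr (P / s)"
    proof (rule K(2))
      show "\<forall>k z. (\<forall>l. l \<noteq> k \<longrightarrow> z l \<in> D) \<longrightarrow>
         (\<exists>N (u :: nat \<Rightarrow> nat \<Rightarrow> 'k). \<forall>i<2 ^ n. F (z(k := e i)) = lq_norm q N (\<lambda>t. \<Sum>l<n. rad i l *\<^sub>R u t l))"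
      proof (intro allI impI)
        fix k and z :: "'m \<Rightarrow> 'y" assume "\<forall>l. l \<noteq> k \<longrightarrow> z l \<in> D"
        then have z: "\<And>l. l \<noteq> k \<Longrightarrow> z l \<in> D" by blast
        from rep[OF z] obtain u where
          "\<forall>c. F (z(k := \<Sum>i<n. sY (c i) (b i))) = lq_norm q N (\<lambda>t. \<Sum>i<n. c i * u t i)" ..
        note u = this[THEN spec]
        have "F (z(k := e i)) = lq_norm q N (\<lambda>t. \<Sum>l<n. rad i l *\<^sub>R u t l)" for i
          unfolding e_sum u by (simp add: scaleR_conv_of_real)
        then show "\<exists>N (u :: nat \<Rightarrow> nat \<Rightarrow> 'k). \<forall>i<2 ^ n. F (z(k := e i)) = lq_norm q N (\<lambda>t. \<Sum>l<n. rad i l *\<^sub>R u t l)"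
          by (intro exI[of _ N] exI[of _ u]) simp
      qed
    qed (use eD F0 in auto)
    define V where "V = (\<nu> * B) powr (1 / s) * \<sigma>"
    have V0: "V \<ge> 0" using \<sigma>0 by (simp add: V_def)
    have "e = (\<lambda>j. \<Sum>l<n. rad j l *\<^sub>R unit_image S l)" by (simp add: e_def b_def fun_eq_iff)
    then have eV: "weak_norm sY s (2 ^ n) e \<le> V"
      using Y.weak_norm_rademacher_le[OF s S less_imp_le[OF B(1)] B(2)] by (simp add: V_def \<nu>_def \<sigma>_def)
    have "(\<Sum>j\<in>?I. norm (T (\<lambda>k. e (j k))) powr s) powr (1 / s) \<le> C0 * (\<Prod>k\<in>(UNIV :: 'm set). weak_norm sY s (2 ^ n) e)"
      by (rule C0(2))
    also have "\<dots> \<le> C0 * (\<Prod>k\<in>(UNIV :: 'm set). V)"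
      using C0(1) Y.weak_norm_nonneg[OF s] eV by (intro mult_left_mono prod_mono) auto
    finally have "((\<Sum>j\<in>?I. norm (T (\<lambda>k. e (j k))) powr s) powr (1 / s)) powr s \<le> (C0 * V ^ m) powr s"
      using s by (intro powr_mono2) (auto simp: m_def)
    then have Te: "(\<Sum>j\<in>?I. norm (T (\<lambda>k. e (j k))) powr s) \<le> (C0 * V ^ m) powr s"
      using s by (simp add: powr_powr sum_nonneg)
    have "(\<Sum>j\<in>?I. F (\<lambda>k. e (j k)) powr s) \<le> (\<Sum>j\<in>?I. (r' * norm (T (\<lambda>k. e (j k)))) powr s)"
      using s F0 F_le eD by (intro sum_mono powr_mono2) auto
    also have "\<dots> = r' powr s * (\<Sum>j\<in>?I. norm (T (\<lambda>k. e (j k))) powr s)"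
      using r'0 by (simp add: powr_mult sum_distrib_left)
    also have "\<dots> \<le> r' powr s * (C0 * V ^ m) powr s"
      using Te by (intro mult_left_mono) auto
    also have "\<dots> = (r' * C0 * \<sigma> ^ m) powr s * (\<nu> ^ m * B ^ m)"
    proof -
      have "(((\<nu> * B) powr (1 / s)) ^ m) powr s = (\<nu> * B) ^ m"
        using \<nu> B(1) s by (simp add: powr_powr flip: powr_realpow)
      then have "(V ^ m) powr s = (\<sigma> ^ m) powr s * (\<nu> ^ m * B ^ m)"
        using \<sigma>0 by (simp add: V_def power_mult_distrib powr_mult mult.commute)
      then show ?thesis using r'0 C0(1) V0 \<sigma>0 by (simp add: powr_mult)
    qed
    finally have "mean ?I (\<lambda>j. F (\<lambda>k. e (j k)) powr s) \<le> (r' * C0 * \<sigma> ^ m) powr s * B ^ m"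
      using \<nu> by (simp add: mean_def card_multi_indices divide_le_eq mult_ac flip: \<nu>_def m_def)
    then have "mean ?I (\<lambda>j. F (\<lambda>k. e (j k)) powr s) powr (P / s) \<le> ((r' * C0 * \<sigma> ^ m) powr s * B ^ m) powr (P / s)"
      using s P0 by (intro powr_mono2 mean_nonneg) auto
    also have "\<dots> = (r' * C0 * \<sigma> ^ m) powr P * (B ^ m) powr (P / s)"
      using s B(1) by (simp add: powr_mult powr_powr)
    finally have 3: "mean ?I (\<lambda>j. F (\<lambda>k. e (j k)) powr s) powr (P / s) \<le> (r' * C0 * \<sigma> ^ m) powr P * (B ^ m) powr (P / s)" .
    have "(\<Sum>j\<in>multi_indices J. norm (T (\<lambda>k. x k (j k))) powr P) \<le> (\<Sum>j\<in>multi_indices J. (\<sigma>' * F (\<lambda>k. x k (j k))) powr P)"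
      using P0 xD by (intro sum_mono powr_mono2 le_F) (auto simp: multi_indices_def)
    also have "\<dots> = \<sigma>' powr P * (\<Sum>j\<in>multi_indices J. F (\<lambda>k. x k (j k)) powr P)"
      using \<sigma>'0 F0 by (simp add: powr_mult sum_distrib_left)
    also have "\<dots> \<le> \<sigma>' powr P * (C1 ^ m * (r ^ m * (\<Prod>k\<in>UNIV. w k)) powr P * (K * ((r' * C0 * \<sigma> ^ m) powr P * (B ^ m) powr (P / s))))"
      using K(1) C1(1) order_trans[OF 2 mult_left_mono[OF 3]]
      by (intro mult_left_mono order_trans[OF 1]) auto
    also have "\<dots> = G * (C0 * (\<sigma>' * r') * (\<sigma> * r) ^ m * (\<Prod>k\<in>UNIV. w k)) powr P"
      using \<sigma>'0 r'0 \<sigma>0 r0 C0(1) w0 by (simp add: G_def powr_mult power_mult_distrib prod_nonneg mult_ac)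
    also have "\<dots> \<le> G * (C0 * (LX + 1) * (LY + 1) ^ m * (\<Prod>k\<in>UNIV. w k)) powr P"
      using G P0 C0(1) \<sigma>'0 r'0 \<sigma>0 r0 w0 rs rs' LX(1) LY(1)
      by (intro mult_left_mono powr_mono2 mult_mono power_mono)
        (auto simp: r_def \<sigma>_def r'_def \<sigma>'_def intro!: mult_nonneg_nonneg prod_nonneg)
    finally have "(\<Sum>j\<in>multi_indices J. norm (T (\<lambda>k. x k (j k))) powr P) powr (1 / P)
        \<le> (G * (C0 * (LX + 1) * (LY + 1) ^ m * (\<Prod>k\<in>UNIV. w k)) powr P) powr (1 / P)"
      using P0 by (intro powr_mono2) (auto intro: sum_nonneg)
    also have "\<dots> = C * (\<Prod>k\<in>UNIV. w k)"
      using G P0 C0(1) LX(1) LY(1) w0 by (simp add: C_def powr_mult powr_powr prod_nonneg)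
    finally show ?thesis by (simp add: w_def)
  qed
  have "C > 0" using G C0(1) LX(1) LY(1) by (simp add: C_def)
  then show "T \<in> multiple_summing sY sX P"
    using T main unfolding multiple_summing_def multi_indices_def by blast
qed

theorem proposition1p5:
  fixes sY :: "'k::real_or_complex \<Rightarrow> 'y::banach \<Rightarrow> 'y"
    and sX :: "'k \<Rightarrow> 'x::banach \<Rightarrow> 'x"
    and p q :: real
  assumes "normed_space_over sY" and "normed_space_over sX"
    and "1 \<le> q" and "0 < p"
    and "Lg_space sY 2" and "Lg_space sX q"
  shows "(p \<ge> q \<longrightarrow>
           (multiple_summing sY sX p :: (('m::finite \<Rightarrow> 'y) \<Rightarrow> 'x) set) = multiple_summing sY sX q) \<and>
         (p \<le> q \<longrightarrow>
           (multiple_summing sY sX p :: (('m \<Rightarrow> 'y) \<Rightarrow> 'x) set) \<subseteq> multiple_summing sY sX q)"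
proof -
  have q: "0 < q" using assms(3) by simp
  note subset = multiple_summing_subset[OF assms(1,2) q _ _ assms(5,6), where 'm = 'm]
  have "(multiple_summing sY sX p :: (('m \<Rightarrow> 'y) \<Rightarrow> 'x) set) \<subseteq> multiple_summing sY sX q"
    by (rule subset[OF assms(4)]) simp
  moreover have "(multiple_summing sY sX q :: (('m \<Rightarrow> 'y) \<Rightarrow> 'x) set) \<subseteq> multiple_summing sY sX p" if "q \<le> p"
    by (rule subset[OF q that])
  ultimately show ?thesis by blast
qed

end
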